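(* There exist $T>0$, a uniformly continuous, weakly divergence-free velocity field $\widetilde V:[0,T]\times\mathbb{R}^2\to\mathbb{R}^2$, and a compact set $S\subset\mathbb{R}^2$ with $\dim_H S=2$, such that $\widetilde V$ admits a trajectory map $X_{\widetilde V}:[0,T]\times\mathbb{R}^2\to\mathbb{R}^2$ satisfying $\dim_H X_{\widetilde V}(t,S)=2$ for all $t\in[0,T)$ and $X_{\widetilde V}(T,S)=\{0\}$. Moreover, for every $t\in[0,T]$, $\widetilde V(t,\cdot)$ is locally Lipschitz on $\mathbb{R}^2\setminus\{(0,0)\}$.
   Context: Trajectory map: Given $U\in C([0,T]\times\mathbb{R}^d;\mathbb{R}^d)$ and $A\subset\mathbb{R}^d$, a map $X_U:[0,T]\times A\to\mathbb{R}^d$ is a trajectory map for $U$ on $A$ if for every $a\in A$ the map $t\mapsto X_U(t,a)$ is differentiable at all $t\in[0,T]$ and $\partial_tX_U(t,a)=U(t,X_U(t,a))$, $X_U(0,a)=a$. When $A$ is not specified, $A=\mathbb{R}^d$. $\dim_H$ denotes Hausdorff dimension. *)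

theory Defs
  imports "HOL-Analysis.Analysis"
begin

(* delta-approximating Hausdorff outer measure of exponent s (normalisation constant omitted;
   it does not affect Hausdorff dimension) *)
definition hausdorff_pre :: "real \<Rightarrow> real \<Rightarrow> 'a::metric_space set \<Rightarrow> ennreal" where
  "hausdorff_pre s \<delta> A =
     (INF U \<in> {U :: nat \<Rightarrow> 'a set. A \<subseteq> (\<Union>i. U i) \<and> (\<forall>i. bounded (U i) \<and> diameter (U i) \<le> \<delta>)}.
        (\<Sum>i. ennreal (diameter (U i) powr s)))"

definition hausdorff_outer :: "real \<Rightarrow> 'a::metric_space set \<Rightarrow> ennreal" where
  "hausdorff_outer s A = (SUP \<delta> \<in> {0<..}. hausdorff_pre s \<delta> A)"

definition hausdorff_dim :: "'a::metric_space set \<Rightarrow> real" where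
  "hausdorff_dim A = Inf {s. s > 0 \<and> hausdorff_outer s A = 0}"

fun Ck :: "nat \<Rightarrow> ('a::real_normed_vector \<Rightarrow> real) \<Rightarrow> bool" where
  "Ck 0 f = continuous_on UNIV f"
| "Ck (Suc k) f = ((\<forall>x. f differentiable (at x)) \<and> continuous_on UNIV f \<and>
      (\<forall>v. Ck k (\<lambda>x. frechet_derivative f (at x) v)))"

definition smooth_fun :: "('a::real_normed_vector \<Rightarrow> real) \<Rightarrow> bool" where
  "smooth_fun f \<longleftrightarrow> (\<forall>k. Ck k f)"

definition test_function :: "('a::real_normed_vector \<Rightarrow> real) \<Rightarrow> bool" where
  "test_function \<phi> \<longleftrightarrow> smooth_fun \<phi> \<and> compact (closure {x. \<phi> x \<noteq> 0})"

definition weakly_div_free :: "real \<Rightarrow> (real \<Rightarrow> real^2 \<Rightarrow> real^2) \<Rightarrow> bool" where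
  "weakly_div_free T V \<longleftrightarrow>
     (\<forall>t\<in>{0..T}. \<forall>\<phi>. test_function \<phi> \<longrightarrow>
        integral UNIV (\<lambda>x. frechet_derivative \<phi> (at x) (V t x)) = 0)"

definition trajectory_map ::
  "real \<Rightarrow> (real \<Rightarrow> 'a::euclidean_space \<Rightarrow> 'a) \<Rightarrow> 'a set \<Rightarrow> (real \<Rightarrow> 'a \<Rightarrow> 'a) \<Rightarrow> bool" where
  "trajectory_map T U A X \<longleftrightarrow>
     (\<forall>a\<in>A. X 0 a = a \<and>
        (\<forall>t\<in>{0..T}. ((\<lambda>s. X s a) has_vector_derivative U t (X t a)) (at t within {0..T})))"

definition locally_lipschitz_on :: "'a::metric_space set \<Rightarrow> ('a \<Rightarrow> 'b::metric_space) \<Rightarrow> bool" where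
  "locally_lipschitz_on S f \<longleftrightarrow>
     (\<forall>x\<in>S. \<exists>r>0. \<exists>L. L-lipschitz_on (ball x r \<inter> S) f)"

end

(*
  The set S is (the closure of) a product of two Cantor sets of length zero and dimension one, coded
  by the binary digits of the two coordinates: digit k contributes c k / 2^k, where the weights c
  decrease to 0 more slowly than any exponential.  Lowering the weight c k at a single level k moves
  the two halves of each level-k piece closer together, and it is realised by three shears whose size
  is comparable to the diameter of the current set: move the pieces with k-th digit 1 aside,
  shift them, and move them back.  Lowering the weights level by level shrinks
  the set to a point: about s^2 moves bring its diameter down to order s^(-8), so that the n-th shear
  can be run in the time interval [n/(n+1), (n+1)/(n+2)] with velocities tending to 0.

  At each time the field is a multiple of a single shear: Lipschitz, divergence-free, and with explicit flow.
  Before time 1 the flow is a finite composition of bi-Lipschitz shears, so that it preserves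
  dimension 2, which is certified by Hoelder maps onto the unit square with exponents close to 1
  (the Cantor function in each coordinate).
*)
theory Submission
  imports Defs "HOL-Real_Asymp.Real_Asymp" "HOL-Library.Nat_Bijection"
begin

section \<open>Planar sets of Hausdorff dimension two\<close>

text \<open>A shear in direction i reads only the other coordinate, whereas the digit to be changed
  is stored in coordinate i itself. The detour through the other coordinate resolves this; it costs
  displacements comparable with the diameter of the whole set, however small the change of the
  weight is.

  A shear can single out the pieces with a given digit only if they lie at a positive distance from
  the others. For weights that decrease to 0 the tail beyond level k is strictly smaller than c k /
  2^k, which provides such a gap at every level. Every intermediate weight sequence therefore has to
  stay decreasing, and this dictates the order of the moves.

  The gaps may be arbitrarily small: a small gap makes the Lipschitz constant of a shear large, but
  uniform continuity of the field comes from uniform convergence of the sum over all stages, where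
  only the amplitudes count.\<close>

definition hoelder_onto_square :: "(real^2) set \<Rightarrow> bool" where
  "hoelder_onto_square E \<longleftrightarrow> (\<forall>\<alpha>. 0 < \<alpha> \<and> \<alpha> < 1 \<longrightarrow> (\<exists>(G :: real^2 \<Rightarrow> real^2) C.
     (\<forall>x\<in>E. \<forall>y\<in>E. dist (G x) (G y) \<le> C * dist x y powr \<alpha>) \<and> box 0 One \<subseteq> G ` E))"

text \<open>A cover of E is carried to a cover of the unit square by boxes of area 4 C^2 times
  diameter^(2 \<alpha>), and these areas must add up to at least 1. The case \<delta> = 1 suffices
  because the outer measure is a supremum over \<delta>. With \<alpha> = 1 the same argument would
  force E to have positive area, so exponents below 1 are all that a null set can offer.\<close>

lemma hoelder_onto_square_imp_outer_pos:
  assumes E: "hoelder_onto_square E" "E \<subseteq> K" and \<alpha>: "0 < \<alpha>" "\<alpha> < 1"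
  shows "hausdorff_outer (2 * \<alpha>) K \<noteq> 0"
proof -
  obtain G :: "real^2 \<Rightarrow> real^2" and C0 where
    G0: "\<And>x y. x \<in> E \<Longrightarrow> y \<in> E \<Longrightarrow> dist (G x) (G y) \<le> C0 * dist x y powr \<alpha>" and
    onto: "box 0 One \<subseteq> G ` E"
    using E(1) \<alpha> unfolding hoelder_onto_square_def by blast
  define C where "C = max C0 1"
  have C: "C \<ge> 1" by (simp add: C_def)
  have G: "dist (G x) (G y) \<le> C * dist x y powr \<alpha>" if "x \<in> E" "y \<in> E" for x y
  proof -
    have "C0 * dist x y powr \<alpha> \<le> C * dist x y powr \<alpha>"
      by (intro mult_right_mono) (auto simp: C_def)
    then show ?thesis using G0[OF that] by linarith
  qed
  have lower: "ennreal (1 / (4 * C^2)) \<le> hausdorff_pre (2 * \<alpha>) 1 K"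
    unfolding hausdorff_pre_def
  proof (rule INF_greatest, clarify)
    fix U :: "nat \<Rightarrow> (real^2) set"
    assume cov: "K \<subseteq> (\<Union>i. U i)" and bd: "\<forall>i. bounded (U i) \<and> diameter (U i) \<le> 1"
    define D where "D i = C * diameter (U i) powr \<alpha>" for i
    \<comment> \<open>The images of \<open>E \<inter> U i\<close> under \<open>G\<close> may fail to
      be measurable, so each is enlarged to a closed box around one of its points; an empty piece
      has no such point and gets the empty box.\<close>
    define B where "B i = (if E \<inter> U i = {} then {} else
       (let z = G (SOME x. x \<in> E \<inter> U i) in cbox (z - D i *\<^sub>R One) (z + D i *\<^sub>R One)))" for i
    have D0: "D i \<ge> 0" for i using C by (simp add: D_def)
    have sub: "G ` (E \<inter> U i) \<subseteq> B i" for i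
    proof (cases "E \<inter> U i = {}")
      case False
      define w where "w = (SOME x. x \<in> E \<inter> U i)"
      have w: "w \<in> E \<inter> U i" unfolding w_def using False by (metis ex_in_conv someI_ex)
      have "G x \<in> cbox (G w - D i *\<^sub>R One) (G w + D i *\<^sub>R One)" if x: "x \<in> E \<inter> U i" for x
      proof -
        have "dist x w \<le> diameter (U i)"
          using bd x w by (intro diameter_bounded_bound) auto
        then have "dist x w powr \<alpha> \<le> diameter (U i) powr \<alpha>"
          using \<alpha> by (intro powr_mono2) auto
        then have "C * dist x w powr \<alpha> \<le> D i"
          using C by (simp add: D_def)
        then have "dist (G x) (G w) \<le> D i"
          using G[of x w] x w by auto
        then have "norm (G x - G w) \<le> D i" by (simp add: dist_norm)
        then have "\<bar>(G x - G w) \<bullet> b\<bar> \<le> D i" if "b \<in> Basis" for b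
          using Basis_le_norm[OF that, of "G x - G w"] by linarith
        then show ?thesis
          by (auto simp: mem_box algebra_simps abs_le_iff)
      qed
      then show ?thesis using False by (auto simp: B_def w_def Let_def)
    qed simp
    have meas: "B i \<in> sets lborel" for i by (auto simp: B_def Let_def)
    have em: "emeasure lborel (B i) \<le> ennreal (4 * C^2) * ennreal (diameter (U i) powr (2*\<alpha>))" for i
    proof -
      have pw: "(2 * D i)^2 = 4 * C^2 * diameter (U i) powr (2*\<alpha>)"
        by (simp add: D_def power_mult_distrib powr_powr mult.commute flip: powr_numeral powr_mult_base)
      have "emeasure lborel (cbox (z - D i *\<^sub>R One) (z + D i *\<^sub>R One)) = ennreal ((2 * D i)^2)" for z :: "real^2"
      proof -
        have *: "(z + D i *\<^sub>R One - (z - D i *\<^sub>R One)) \<bullet> b = 2 * D i" if "b \<in> Basis" for b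
          unfolding inner_diff_left inner_add_left inner_scaleR_left using that by simp
        have **: "\<forall>b\<in>Basis. (z - D i *\<^sub>R One) \<bullet> b \<le> (z + D i *\<^sub>R One) \<bullet> b"
          using D0[of i] by (simp add: inner_simps)
        show ?thesis
          unfolding emeasure_lborel_cbox_eq if_P[OF **] by (subst prod.cong[OF refl *]) auto
      qed
      then have "emeasure lborel (B i) \<le> ennreal ((2 * D i)^2)"
        by (auto simp: B_def Let_def)
      then show ?thesis unfolding pw by (simp add: ennreal_mult)
    qed
    have "(1::ennreal) = emeasure lborel (box 0 (One :: real^2))"
      by (simp add: emeasure_lborel_box_eq)
    also have "\<dots> \<le> emeasure lborel (\<Union>i. B i)"
    proof (rule emeasure_mono)
      have "G ` E \<subseteq> (\<Union>i. B i)"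
      proof
        fix y assume "y \<in> G ` E"
        then obtain x where x: "x \<in> E" "y = G x" by blast
        then obtain i where "x \<in> U i" using cov E(2) by blast
        then have "y \<in> B i" using sub[of i] x by blast
        then show "y \<in> (\<Union>i. B i)" by blast
      qed
      with onto show "box 0 One \<subseteq> (\<Union>i. B i)" by (rule order_trans)
      show "(\<Union>i. B i) \<in> sets lborel" by (intro sets.countable_UN image_subsetI meas)
    qed
    also have "\<dots> \<le> (\<Sum>i. emeasure lborel (B i))"
      by (intro emeasure_subadditive_countably image_subsetI meas)
    also have "\<dots> \<le> (\<Sum>i. ennreal (4 * C^2) * ennreal (diameter (U i) powr (2*\<alpha>)))"
      by (rule suminf_le[OF em]) simp_all
    also have "\<dots> = ennreal (4 * C^2) * (\<Sum>i. ennreal (diameter (U i) powr (2*\<alpha>)))"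
      by (rule ennreal_suminf_cmult)
    finally have *: "1 \<le> ennreal (4 * C^2) * (\<Sum>i. ennreal (diameter (U i) powr (2*\<alpha>)))" .
    have "ennreal (1 / (4 * C^2)) * 1 \<le> ennreal (1 / (4 * C^2)) * (ennreal (4 * C^2) * (\<Sum>i. ennreal (diameter (U i) powr (2*\<alpha>))))"
      by (rule mult_left_mono[OF *]) simp
    also have "\<dots> = (\<Sum>i. ennreal (diameter (U i) powr (2*\<alpha>)))"
      using C by (simp add: mult.assoc[symmetric] ennreal_mult[symmetric] del: ennreal_suminf_cmult)
    finally show "ennreal (1 / (4 * C^2)) \<le> (\<Sum>i. ennreal (diameter (U i) powr (2*\<alpha>)))" by simp
  qed
  also have "\<dots> \<le> hausdorff_outer (2 * \<alpha>) K"
    unfolding hausdorff_outer_def by (rule SUP_upper) simp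
  finally show ?thesis using C by (auto simp: ennreal_eq_0_iff)
qed

text \<open>A grid of N^2 cells of diameter at most 4 R / N contributes at most N^2 (4 R / N)^s,
  which tends to 0 because s exceeds 2.\<close>

lemma hausdorff_outer_planar_eq_0:
  fixes K :: "(real^2) set"
  assumes K: "bounded K" and s: "s > 2"
  shows "hausdorff_outer s K = 0"
proof -
  obtain R where R: "R > 0" "\<And>x. x \<in> K \<Longrightarrow> norm x < R"
    using K by (metis bounded_pos_less)
  have pre: "hausdorff_pre s \<delta> K = 0" if \<delta>: "\<delta> > 0" for \<delta>
  proof -
    \<comment> \<open>The numbers \<open>i div N\<close> and \<open>i mod N\<close> are the two grid
      positions of cell i; the cells from N * N on are empty and contribute 0 to the infinite
      sum.\<close>
    define cell where "cell N i = (if i < N * N then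
      {x :: real^2. x $ 1 \<in> {2*R*(real (i div N) / N) - R..2*R*(real (i div N) / N) - R + 2*R/N} \<and>
        x $ 2 \<in> {2*R*(real (i mod N) / N) - R..2*R*(real (i mod N) / N) - R + 2*R/N}} else {})"
      for N i :: nat
    have dist_cell: "dist x y \<le> 4*R/N" if "x \<in> cell N i" "y \<in> cell N i" for x y N i
    proof -
      have "dist x y \<le> (\<Sum>j\<in>UNIV. \<bar>(x - y) $ j\<bar>)"
        unfolding dist_norm by (rule norm_le_l1_cart)
      also have "\<dots> = \<bar>x$1 - y$1\<bar> + \<bar>x$2 - y$2\<bar>" by (simp add: sum_2)
      also have "\<dots> \<le> 2*R/N + 2*R/N"
        using that by (intro add_mono) (auto simp: cell_def split: if_splits)
      finally show ?thesis by simp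
    qed
    have bd: "bounded (cell N i)" for N i
    proof (cases "cell N i = {}")
      case False
      then obtain z where "z \<in> cell N i" by blast
      then have "cell N i \<subseteq> cball z (4*R/N)" using dist_cell by auto
      then show ?thesis using bounded_cball bounded_subset by blast
    qed simp
    have diam: "diameter (cell N i) \<le> 4*R/N" for N i
      using dist_cell R by (intro diameter_le) (auto simp: dist_norm)
    have cover: "K \<subseteq> (\<Union>i. cell N i)" if N: "N > 0" for N
    proof
      fix x assume x: "x \<in> K"
      have idx: "\<exists>p<N. x $ k \<in> {2*R*(real p / N) - R..2*R*(real p / N) - R + 2*R/N}" for k
      proof -
        define u where "u = (x $ k + R) * N / (2*R)"
        have ab: "\<bar>x $ k\<bar> < R" using R(2)[OF x] component_le_norm_cart[of x k] by linarith
        have "0 \<le> x $ k + R" "x $ k + R < 2 * R" using ab by auto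
        then have u: "0 \<le> u" "u < N" using R N by (auto simp: u_def divide_less_eq mult.commute)
        define p where "p = nat \<lfloor>u\<rfloor>"
        have p: "real p \<le> u" "u < real p + 1" using u by (auto simp: p_def)
        have "p < N" using p u by linarith
        moreover have "x $ k = 2*R*(u/N) - R" using R N by (simp add: u_def field_simps)
        moreover have "2*R*(real p / N) \<le> 2*R*(u/N)"
          using p R N by (intro mult_left_mono divide_right_mono) auto
        moreover have "2*R*(u/N) \<le> 2*R*((real p + 1)/N)"
          using p R N by (intro mult_left_mono divide_right_mono) auto
        ultimately show ?thesis by (intro exI[of _ p]) (auto simp: add_divide_distrib distrib_left)
      qed
      obtain p q where pq: "p < N" "q < N"
        "x $ 1 \<in> {2*R*(real p / N) - R..2*R*(real p / N) - R + 2*R/N}"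
        "x $ 2 \<in> {2*R*(real q / N) - R..2*R*(real q / N) - R + 2*R/N}"
        using idx[of 1] idx[of 2] by blast
      have "p * N + q < p * N + N" using pq by simp
      also have "\<dots> = Suc p * N" by simp
      also have "\<dots> \<le> N * N" using pq by (intro mult_right_mono) auto
      finally have "x \<in> cell N (p * N + q)" using pq by (auto simp: cell_def)
      then show "x \<in> (\<Union>i. cell N i)" by blast
    qed
    have bnd: "hausdorff_pre s \<delta> K \<le> ennreal (real N * real N * (4*R/N) powr s)"
      if N: "N > 0" "4*R/N \<le> \<delta>" for N :: nat
    proof -
      have "hausdorff_pre s \<delta> K \<le> (\<Sum>i. ennreal (diameter (cell N i) powr s))"
        unfolding hausdorff_pre_def
        using cover[OF N(1)] bd order_trans[OF diam N(2)] by (intro INF_lower) auto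
      also have "\<dots> = (\<Sum>i<N*N. ennreal (diameter (cell N i) powr s))"
        by (intro suminf_finite) (auto simp: cell_def)
      also have "\<dots> \<le> (\<Sum>i<N*N. ennreal ((4*R/N) powr s))"
        using diam s by (intro sum_mono ennreal_leI powr_mono2) (auto simp: diameter_ge_0 bd)
      also have "\<dots> = ennreal (real N * real N * (4*R/N) powr s)"
        by (simp add: ennreal_mult' ennreal_of_nat_eq_real_of_nat)
      finally show ?thesis .
    qed
    have lim: "(\<lambda>N. ennreal (real N * real N * (4*R/N) powr s)) \<longlonglongrightarrow> ennreal 0"
    proof (rule tendsto_ennrealI)
      have "(\<lambda>N::nat. (4*R) powr s * real N powr (2 - s)) \<longlonglongrightarrow> (4*R) powr s * 0"
        by (intro tendsto_mult tendsto_const tendsto_neg_powr filterlim_real_sequentially)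
          (use s in auto)
      moreover have "eventually (\<lambda>N::nat. (4*R) powr s * real N powr (2 - s) = real N * real N * (4*R/N) powr s) sequentially"
        using eventually_gt_at_top[of 0]
      proof eventually_elim
        case (elim N)
        then have "real N powr (2 - s) = real N * real N / real N powr s"
          by (simp add: powr_diff power2_eq_square)
        then show ?case using R elim by (simp add: powr_divide)
      qed
      ultimately show "(\<lambda>N. real N * real N * (4*R/N) powr s) \<longlonglongrightarrow> 0"
        by (simp add: Lim_transform_eventually)
    qed
    have "(\<lambda>N. 4*R/real N) \<longlonglongrightarrow> 0" by (rule lim_const_over_n)
    then have "eventually (\<lambda>N. 4*R/real N < \<delta>) sequentially"
      using \<delta> by (rule order_tendstoD)
    then have "eventually (\<lambda>N. hausdorff_pre s \<delta> K \<le> ennreal (real N * real N * (4*R/N) powr s)) sequentially"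
      using eventually_gt_at_top[of 0] by eventually_elim (auto intro: bnd)
    then have "hausdorff_pre s \<delta> K \<le> ennreal 0"
      by (intro tendsto_lowerbound[OF lim]) auto
    then show ?thesis by simp
  qed
  have "hausdorff_outer s K \<le> 0"
    unfolding hausdorff_outer_def using pre by (intro SUP_least) auto
  then show ?thesis by simp
qed

text \<open>The exponents of vanishing measure include everything above 2 and nothing below 2, which
  fixes the infimum whatever happens at 2. The lower bound is inherited from a subset: later E
  consists of digit points or their images, while K comes from the closure.\<close>

lemma hausdorff_dim_eq_2:
  assumes "hoelder_onto_square E" "E \<subseteq> K" "bounded K"
  shows "hausdorff_dim K = 2"
  unfolding hausdorff_dim_def
proof (rule cInf_eq)
  fix s assume s: "s \<in> {s. s > 0 \<and> hausdorff_outer s K = 0}"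
  show "2 \<le> s"
  proof (rule ccontr)
    assume "\<not> 2 \<le> s"
    then have "hausdorff_outer (2 * (s/2)) K \<noteq> 0"
      using s by (intro hoelder_onto_square_imp_outer_pos[OF assms(1,2)]) auto
    then show False using s by simp
  qed
next
  fix y assume y: "\<And>x. x \<in> {s. s > 0 \<and> hausdorff_outer s K = 0} \<Longrightarrow> y \<le> x"
  show "y \<le> 2"
  proof (rule dense_ge)
    fix z :: real assume "2 < z"
    then show "y \<le> z" using hausdorff_outer_planar_eq_0[OF assms(3)] by (intro y) auto
  qed
qed

text \<open>Composing the Hoelder map with the Lipschitz left inverse \<open>F'\<close> keeps the
  exponent and changes the constant by the factor \<open>L powr \<alpha>\<close>. Later F is the
  flow at a time before 1.\<close>

lemma hoelder_onto_square_image: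
  assumes E: "hoelder_onto_square E"
    and F: "L-lipschitz_on UNIV F'" "\<And>x. F' (F x) = x"
  shows "hoelder_onto_square (F ` E)"
  unfolding hoelder_onto_square_def
proof (intro allI impI)
  fix \<alpha> :: real assume \<alpha>: "0 < \<alpha> \<and> \<alpha> < 1"
  obtain G :: "real^2 \<Rightarrow> real^2" and C0 where
    G0: "\<And>x y. x \<in> E \<Longrightarrow> y \<in> E \<Longrightarrow> dist (G x) (G y) \<le> C0 * dist x y powr \<alpha>" and
    onto: "box 0 One \<subseteq> G ` E"
    using E \<alpha> unfolding hoelder_onto_square_def by blast
  define C where "C = \<bar>C0\<bar>"
  have C: "C \<ge> 0" by (simp add: C_def)
  have "dist (G x) (G y) \<le> C * L powr \<alpha> * dist (F x) (F y) powr \<alpha>" if "x \<in> E" "y \<in> E" for x y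
  proof -
    have "L \<ge> 0" using F(1) lipschitz_on_nonneg by blast
    have "dist x y \<le> L * dist (F x) (F y)"
      using lipschitz_onD[OF F(1), of "F x" "F y"] F(2) by simp
    then have "dist x y powr \<alpha> \<le> (L * dist (F x) (F y)) powr \<alpha>"
      using \<alpha> by (intro powr_mono2) auto
    also have "\<dots> = L powr \<alpha> * dist (F x) (F y) powr \<alpha>"
      using \<open>L \<ge> 0\<close> by (simp add: powr_mult)
    finally have *: "C * dist x y powr \<alpha> \<le> C * (L powr \<alpha> * dist (F x) (F y) powr \<alpha>)"
      using C by (intro mult_left_mono) auto
    have "C0 * dist x y powr \<alpha> \<le> C * dist x y powr \<alpha>"
      by (intro mult_right_mono) (auto simp: C_def)
    then show ?thesis using G0[OF that] * by (simp add: mult.assoc)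
  qed
  moreover have "box 0 One \<subseteq> (\<lambda>z. G (F' z)) ` (F ` E)"
    using onto F(2) by (simp add: image_image)
  ultimately show "\<exists>(G :: real^2 \<Rightarrow> real^2) C. (\<forall>x\<in>F ` E. \<forall>y\<in>F ` E. dist (G x) (G y) \<le> C * dist x y powr \<alpha>)
      \<and> box 0 One \<subseteq> G ` F ` E"
    using F(2) by (intro exI[of _ "\<lambda>z. G (F' z)"] exI[of _ "C * L powr \<alpha>"]) auto
qed

section \<open>Cantor sets with slowly decreasing weights\<close>

text \<open>With constant weights 1/2 this is the ordinary binary expansion, so the points of the
  Cantor set and the values of the Cantor function come from one and the same map of digits.\<close>

definition digit_sum :: "(nat \<Rightarrow> real) \<Rightarrow> (nat \<Rightarrow> bool) \<Rightarrow> real" where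
  "digit_sum c b = (\<Sum>k. of_bool (b k) * c k / 2 ^ k)"

definition null_weights :: "(nat \<Rightarrow> real) \<Rightarrow> bool" where
  "null_weights c \<longleftrightarrow> decseq c \<and> c \<longlonglongrightarrow> 0 \<and> (\<forall>k. c k > 0)"

lemma summable_halves: "summable (\<lambda>k. a / 2 ^ k :: real)"
  using summable_mult[OF summable_geometric[of "1/2::real"], of a] by (simp add: power_one_over)

lemma suminf_halves: "(\<Sum>k. a / 2 ^ k :: real) = 2 * a"
  using suminf_mult[OF summable_geometric[of "1/2::real"], of a] suminf_geometric[of "1/2::real"]
  by (simp add: power_one_over)

lemma null_weights_le: "null_weights c \<Longrightarrow> i \<le> j \<Longrightarrow> c j \<le> c i"
  by (auto simp: null_weights_def decseq_def)

lemma null_weights_pos: "null_weights c \<Longrightarrow> c k > 0"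
  by (auto simp: null_weights_def)

lemma summable_digits:
  assumes "decseq c" "\<And>k. c k \<ge> 0" "\<And>k. \<bar>a k\<bar> \<le> 1"
  shows "summable (\<lambda>k. a k * c k / 2 ^ k :: real)"
proof (rule summable_comparison_test[OF _ summable_halves[of "c 0"]], intro exI allI impI)
  fix k :: nat
  have "\<bar>a k\<bar> * c k \<le> 1 * c 0"
    using assms by (intro mult_mono) (auto simp: decseq_def)
  then show "norm (a k * c k / 2 ^ k) \<le> c 0 / 2 ^ k"
    using assms(2)[of k] by (simp add: abs_mult divide_right_mono)
qed

lemma digit_sum_bounds:
  assumes "null_weights c"
  shows "0 \<le> digit_sum c b" "digit_sum c b \<le> 2 * c 0"
proof -
  have s: "summable (\<lambda>k. of_bool (b k) * c k / 2 ^ k)"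
    using assms by (intro summable_digits) (auto simp: null_weights_def less_imp_le)
  show "0 \<le> digit_sum c b"
    unfolding digit_sum_def using null_weights_pos[OF assms] by (intro suminf_nonneg s) (simp add: less_imp_le)
  have "digit_sum c b \<le> (\<Sum>k. c 0 / 2 ^ k)"
    unfolding digit_sum_def
    using null_weights_pos[OF assms] null_weights_le[OF assms, of 0]
    by (intro suminf_le s summable_halves) (auto intro!: divide_right_mono simp: less_imp_le)
  then show "digit_sum c b \<le> 2 * c 0" by (simp add: suminf_halves)
qed

lemma digit_sum_fun_upd:
  assumes "null_weights c" "null_weights (c(k := x))"
  shows "digit_sum (c(k := x)) b = digit_sum c b + (if b k then (x - c k) / 2 ^ k else 0)"
proof -
  have s: "summable (\<lambda>j. of_bool (b j) * c j / 2 ^ j)" if "null_weights c" for c :: "nat \<Rightarrow> real"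
    using that by (intro summable_digits) (auto simp: null_weights_def less_imp_le)
  have "digit_sum (c(k := x)) b - digit_sum c b
      = (\<Sum>j. of_bool (b j) * (c(k := x)) j / 2 ^ j - of_bool (b j) * c j / 2 ^ j)"
    unfolding digit_sum_def by (rule suminf_diff[OF s s, OF assms(2,1)])
  also have "\<dots> = (\<Sum>j\<in>{k}. of_bool (b j) * (c(k := x)) j / 2 ^ j - of_bool (b j) * c j / 2 ^ j)"
    by (rule suminf_finite) auto
  finally show ?thesis by (cases "b k") (auto simp: diff_divide_distrib algebra_simps)
qed

text \<open>The tail beyond level \<open>k\<close> would cancel the leading term \<open>c k / 2 ^ k\<close> exactly if \<open>c\<close> were constant from \<open>k\<close> on.\<close>
lemma digit_sum_gap:
  assumes c: "null_weights c" and agree: "\<And>j. j < k \<Longrightarrow> b j = b' j" and k: "b k" "\<not> b' k" and m: "k < m"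
  shows "(c k - c m) / 2 ^ m \<le> digit_sum c b - digit_sum c b'"
proof -
  have s: "summable (\<lambda>j. of_bool (b j) * c j / 2 ^ j)" for b
    using c by (intro summable_digits) (auto simp: null_weights_def less_imp_le)
  define t where "t j = (of_bool (b j) - of_bool (b' j)) * c j / 2 ^ j" for j
  have t: "summable t" "suminf t = digit_sum c b - digit_sum c b'"
    using suminf_diff[OF s[of b] s[of b']] summable_diff[OF s[of b] s[of b']]
    by (simp_all add: t_def[abs_def] digit_sum_def left_diff_distrib diff_divide_distrib)
  \<comment> \<open>A termwise minorant of t: c k / 2^k at level k and -c k / 2^j beyond it, which
    cancel in the sum, except that at level m the smaller loss -c m / 2^m is kept. The remainder (c
    k - c m) / 2^m is the gap. It is written as a difference of series with known sums.\<close>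
  define u where "u j = (if j < k then 0 else if j = k then 2 * c k / 2 ^ k else 0) - (if j < k then 0 else c k / 2 ^ j) + (if j = m then (c k - c m) / 2 ^ m else 0)" for j
  have "(\<lambda>j. if j < k then 0 else c k / 2 ^ j) sums (2 * c k / 2 ^ k)"
  proof -
    have "(\<lambda>j. c k / 2 ^ k / 2 ^ j) sums (2 * (c k / 2 ^ k))"
      using summable_sums[OF summable_halves[of "c k / 2 ^ k"]] by (simp only: suminf_halves)
    then have "(\<lambda>j. if j + k < k then 0 else c k / 2 ^ (j + k)) sums (2 * c k / 2 ^ k)"
      by (simp add: power_add mult.commute)
    then show ?thesis
      by (subst (asm) sums_zero_iff_shift) auto
  qed
  moreover have "(\<lambda>j. if j = k then 2 * c k / 2 ^ k else 0) sums (2 * c k / 2 ^ k)"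
    by (rule sums_single)
  moreover have "(\<lambda>j. if j = m then (c k - c m) / 2 ^ m else 0) sums ((c k - c m) / 2 ^ m)"
    by (rule sums_single)
  ultimately have "(\<lambda>j. (if j = k then 2 * c k / 2 ^ k else 0) - (if j < k then 0 else c k / 2 ^ j) + (if j = m then (c k - c m) / 2 ^ m else 0))
      sums (2 * c k / 2 ^ k - 2 * c k / 2 ^ k + (c k - c m) / 2 ^ m)"
    by (intro sums_add sums_diff)
  moreover have "(\<lambda>j. (if j = k then 2 * c k / 2 ^ k else 0) - (if j < k then 0 else c k / 2 ^ j) + (if j = m then (c k - c m) / 2 ^ m else 0)) = u"
    by (auto simp: u_def fun_eq_iff)
  ultimately have u: "u sums ((c k - c m) / 2 ^ m)" by simp
  have "u j \<le> t j" for j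
  proof -
    consider "j < k" | "j = k" | "j > k" by linarith
    then show ?thesis
    proof cases
      case 1 then show ?thesis using agree m by (simp add: u_def t_def)
    next
      case 2 then show ?thesis using k m by (simp add: u_def t_def)
    next
      case 3
      have "c j \<le> c k" using 3 null_weights_le[OF c] by simp
      then have "- c k \<le> - c j" by simp
      moreover have "- c j \<le> (of_bool (b j) - of_bool (b' j)) * c j"
        using null_weights_pos[OF c, of j] by auto
      ultimately have "- c k / 2 ^ j \<le> t j" "- c j / 2 ^ j \<le> t j"
        unfolding t_def by (intro divide_right_mono; simp)+
      then show ?thesis using 3 by (auto simp: u_def diff_divide_distrib)
    qed
  qed
  then have "suminf u \<le> suminf t"
    using u t by (intro suminf_le) (auto simp: sums_iff)
  then show ?thesis using u t by (simp add: sums_iff)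
qed

lemma digit_sum_dist:
  assumes c: "null_weights c" and agree: "\<And>j. j < k \<Longrightarrow> b j = b' j" and k: "b k \<noteq> b' k" and m: "k < m"
  shows "(c k - c m) / 2 ^ m \<le> \<bar>digit_sum c b - digit_sum c b'\<bar>"
proof (cases "b k")
  case True
  then show ?thesis using digit_sum_gap[OF c agree _ _ m] k by fastforce
next
  case False
  then have "(c k - c m) / 2 ^ m \<le> digit_sum c b' - digit_sum c b"
    using k by (intro digit_sum_gap[OF c _ _ _ m]) (auto simp: agree)
  then show ?thesis by linarith
qed

text \<open>Sequences that differ in digit k may first differ at any level j up to k, so \<delta> is
  the least of finitely many gaps, each positive because the weights eventually fall below c j. This
  separation makes the cutoff functions in the shears Lipschitz.\<close>

lemma digit_sum_separated:
  assumes c: "null_weights c"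
  obtains \<delta> where "\<delta> > 0" "\<And>b b'. b k \<noteq> b' k \<Longrightarrow> \<delta> \<le> \<bar>digit_sum c b - digit_sum c b'\<bar>"
proof -
  have "\<exists>m>j. c m < c j" for j
  proof -
    have "eventually (\<lambda>m. c m < c j \<and> m > j) sequentially"
      using c null_weights_pos[OF c, of j]
      by (intro eventually_conj order_tendstoD eventually_gt_at_top) (auto simp: null_weights_def)
    then show ?thesis using eventually_happens'[OF sequentially_bot] by blast
  qed
  then obtain m where m: "\<And>j. m j > j" "\<And>j. c (m j) < c j" by metis
  define \<delta> where "\<delta> = Min ((\<lambda>j. (c j - c (m j)) / 2 ^ m j) ` {..k})"
  have "\<delta> > 0" unfolding \<delta>_def using m(2) by (subst Min_gr_iff) auto
  moreover have "\<delta> \<le> \<bar>digit_sum c b - digit_sum c b'\<bar>" if "b k \<noteq> b' k" for b b'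
  proof -
    define j where "j = (LEAST j. b j \<noteq> b' j)"
    have j: "b j \<noteq> b' j" "j \<le> k" "\<And>i. i < j \<Longrightarrow> b i = b' i"
      unfolding j_def using LeastI[of "\<lambda>j. b j \<noteq> b' j", OF that] Least_le[of "\<lambda>j. b j \<noteq> b' j", OF that]
        not_less_Least[of _ "\<lambda>j. b j \<noteq> b' j"] by blast+
    have "\<delta> \<le> (c j - c (m j)) / 2 ^ m j"
      unfolding \<delta>_def using j(2) by (intro Min_le) auto
    also have "\<dots> \<le> \<bar>digit_sum c b - digit_sum c b'\<bar>"
      by (rule digit_sum_dist[where b = b and b' = b' and k = j, OF c j(3) j(1) m(1)])
    finally show ?thesis .
  qed
  ultimately show ?thesis by (rule that)
qed

section \<open>Binary expansions and the Cantor function\<close>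

lemma binary_value_dist:
  assumes "\<And>j. j < k \<Longrightarrow> b j = b' j"
  shows "\<bar>digit_sum (\<lambda>_. 1/2) b - digit_sum (\<lambda>_. 1/2) b'\<bar> \<le> 1 / 2 ^ k"
proof -
  have s: "summable (\<lambda>j. of_bool (b j) * (1/2) / 2 ^ j :: real)" for b
    by (intro summable_digits) (auto simp: decseq_def)
  define t where "t j = (of_bool (b j) - of_bool (b' j)) * (1/2) / (2::real) ^ j" for j
  have t: "summable t" "suminf t = digit_sum (\<lambda>_. 1/2) b - digit_sum (\<lambda>_. 1/2) b'"
    using suminf_diff[OF s[of b] s[of b']] summable_diff[OF s[of b] s[of b']]
    by (simp_all add: t_def[abs_def] digit_sum_def left_diff_distrib diff_divide_distrib)
  have "suminf t = (\<Sum>j. t (j + k))"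
    using suminf_split_initial_segment[OF t(1), of k] assms by (simp add: t_def)
  also have "\<bar>\<dots>\<bar> \<le> (\<Sum>j. (1/2) / 2 ^ k / 2 ^ j)"
  proof -
    have le: "norm (t (j + k)) \<le> (1/2) / 2 ^ k / 2 ^ j" for j
      by (auto simp: t_def power_add mult_ac)
    have "summable (\<lambda>j. norm (t (j + k)))"
      by (rule summable_comparison_test[OF _ summable_halves[of "(1/2) / 2 ^ k"]]) (use le in auto)
    then have "norm (\<Sum>j. t (j + k)) \<le> (\<Sum>j. norm (t (j + k)))" by (rule summable_norm)
    also have "\<dots> \<le> (\<Sum>j. (1/2) / 2 ^ k / 2 ^ j)"
      by (intro suminf_le le summable_halves) fact
    finally show ?thesis by simp
  qed
  also have "\<dots> = 1 / 2 ^ k" by (subst suminf_halves) simp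
  finally show ?thesis using t by simp
qed

lemma binary_value_surj:
  assumes "0 \<le> x" "x < (1::real)"
  shows "\<exists>b. digit_sum (\<lambda>_. 1/2) b = x"
proof
  \<comment> \<open>With these digits the n-th partial sum is the floor of 2^n x divided by 2^n; the
    induction starts from the floor of x, which is 0 since x lies in [0, 1).\<close>
  define b where "b k = odd \<lfloor>2 ^ Suc k * x\<rfloor>" for k
  have step: "\<lfloor>2 * y\<rfloor> = 2 * \<lfloor>y\<rfloor> + of_bool (odd \<lfloor>2 * y\<rfloor>)" for y :: real
  proof -
    have "\<lfloor>2 * y\<rfloor> div 2 = \<lfloor>y\<rfloor>" 
      using floor_divide_real_eq_div[of 2 "2 * y"] by simp
    then show ?thesis by (metis div_mult_mod_eq mult.commute odd_of_bool_self mod2_eq_if of_bool_def)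
  qed
  have part: "(\<Sum>k<n. of_bool (b k) * (1/2) / 2 ^ k) = \<lfloor>2 ^ n * x\<rfloor> / 2 ^ n" for n
  proof (induction n)
    case 0
    then show ?case using assms by (simp add: floor_eq_iff)
  next
    case (Suc n)
    have "real_of_int \<lfloor>2 ^ Suc n * x\<rfloor> = 2 * real_of_int \<lfloor>2 ^ n * x\<rfloor> + of_bool (b n)"
      using step[of "2 ^ n * x"] by (auto simp: b_def mult.assoc)
    then show ?case using Suc by (simp add: field_simps)
  qed
  have "(\<lambda>n. \<lfloor>2 ^ n * x\<rfloor> / 2 ^ n) \<longlonglongrightarrow> x"
  proof (rule tendsto_sandwich)
    have "(\<lambda>n. x - 1 / 2 ^ n) \<longlonglongrightarrow> x - 0"
      by (intro tendsto_diff tendsto_const) real_asymp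
    then show "(\<lambda>n. x - 1 / 2 ^ n) \<longlonglongrightarrow> x" by simp
    show "eventually (\<lambda>n. x - 1 / 2 ^ n \<le> \<lfloor>2 ^ n * x\<rfloor> / 2 ^ n) sequentially"
    proof (rule always_eventually, rule allI)
      fix n :: nat
      have "2 ^ n * x - 1 \<le> \<lfloor>2 ^ n * x\<rfloor>" by linarith
      then have "(2 ^ n * x - 1) / 2 ^ n \<le> \<lfloor>2 ^ n * x\<rfloor> / 2 ^ n" by (rule divide_right_mono) simp
      then show "x - 1 / 2 ^ n \<le> \<lfloor>2 ^ n * x\<rfloor> / 2 ^ n" by (simp add: diff_divide_distrib)
    qed
    show "eventually (\<lambda>n. \<lfloor>2 ^ n * x\<rfloor> / 2 ^ n \<le> x) sequentially"
      by (intro always_eventually) (auto simp: divide_le_eq mult.commute)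
  qed auto
  then have "(\<lambda>k. of_bool (b k) * (1/2) / 2 ^ k) sums x"
    by (simp only: sums_def part)
  then show "digit_sum (\<lambda>_. 1/2) b = x"
    by (simp only: digit_sum_def sums_iff)
qed

text \<open>Each coordinate has its own weights because a level is lowered in one coordinate at a
  time.\<close>

definition digit_point :: "(2 \<Rightarrow> nat \<Rightarrow> real) \<Rightarrow> (2 \<Rightarrow> nat \<Rightarrow> bool) \<Rightarrow> real^2" where
  "digit_point c \<omega> = (\<chi> i. digit_sum (c i) (\<omega> i))"

text \<open>The exponent 8 is set by the schedule: after j level changes the largest weight is at
  most (j + 1)^(-4), which against the factor (n + 1)^2 from the durations leaves the summable order
  n^(-2). Polynomial decay is slow enough for the Hoelder estimate, where the weights compete with
  powers of 2.\<close>

definition slow_weight :: "nat \<Rightarrow> real" where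
  "slow_weight k = 1 / (real k + 1) ^ 8"

lemma null_weights_slow: "null_weights slow_weight"
  unfolding null_weights_def slow_weight_def
proof (intro conjI allI)
  show "decseq (\<lambda>k. 1 / (real k + 1) ^ 8)"
    by (auto simp: decseq_def intro!: divide_left_mono power_mono)
  show "(\<lambda>k. 1 / (real k + 1) ^ 8) \<longlonglongrightarrow> 0" by real_asymp
qed auto

text \<open>From a (a + 2) \<le> (a + 1)^2 follows a^8 (a + 2) \<le> (a + 1)^9, which is the claim
  for a = k + 1 after division.\<close>

lemma slow_weight_diff: "1 / (real k + 2) ^ 9 \<le> slow_weight k - slow_weight (Suc k)"
proof -
  define a where "a = real k + 1"
  have a: "a \<ge> 1" by (simp add: a_def)
  have pow8: "x ^ 8 = x ^ 7 * x" for x :: real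
    using power_Suc2[of x 7] by simp
  have "a * (a + 2) \<le> (a + 1) * (a + 1)" by (simp add: algebra_simps)
  then have "a ^ 7 * (a * (a + 2)) \<le> (a + 1) ^ 7 * ((a + 1) * (a + 1))"
    using a by (intro mult_mono'[OF power_mono]) auto
  then have "a ^ 8 * (a + 2) \<le> (a + 1) ^ 8 * (a + 1)"
    by (simp only: pow8 mult.assoc)
  then have "1 / (a + 1) ^ 9 \<le> 1 / a ^ 8 - 1 / (a + 1) ^ 8"
    using a by (simp add: divide_simps eval_nat_numeral) (simp add: algebra_simps)
  then show ?thesis by (simp add: slow_weight_def a_def add_ac)
qed

text \<open>If the digits first differ at level k, the binary values are within 2^(-k), while the
  points are at least e = 2^(-k) / (2 (k + 2)^9) apart. Splitting 2^(-k) into 2^(-\<alpha> k) and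
  r^k with r = 2^(\<alpha> - 1) < 1 leaves a geometric factor that absorbs the polynomial loss; at
  \<alpha> = 1 nothing would absorb it.\<close>

lemma cantor_function_hoelder:
  assumes \<alpha>: "0 < \<alpha>" "\<alpha> < 1"
  obtains C where "C \<ge> 0"
    "\<And>b b'. \<bar>digit_sum (\<lambda>_. 1/2) b - digit_sum (\<lambda>_. 1/2) b'\<bar> \<le> C * \<bar>digit_sum slow_weight b - digit_sum slow_weight b'\<bar> powr \<alpha>"
proof -
  define r where "r = 2 powr (\<alpha> - 1)"
  have r: "0 < r" "r < 1" using \<alpha> by (auto simp: r_def powr_less_one)
  have "(\<lambda>k. 2 * (real k + 2) ^ 9 * r ^ k) \<longlonglongrightarrow> 0"
    using r by real_asymp
  then have "Bseq (\<lambda>k. 2 * (real k + 2) ^ 9 * r ^ k)" by (rule convergent_imp_Bseq[OF convergentI])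
  then obtain C where C: "C > 0" "\<And>k. 2 * (real k + 2) ^ 9 * r ^ k \<le> C"
    unfolding Bseq_def by (auto simp: abs_le_iff)
  have "\<bar>digit_sum (\<lambda>_. 1/2) b - digit_sum (\<lambda>_. 1/2) b'\<bar> \<le> C * \<bar>digit_sum slow_weight b - digit_sum slow_weight b'\<bar> powr \<alpha>" for b b'
  proof (cases "b = b'")
    case False
    define k where "k = (LEAST j. b j \<noteq> b' j)"
    have k: "b k \<noteq> b' k" "\<And>i. i < k \<Longrightarrow> b i = b' i"
    proof -
      have "\<exists>j. b j \<noteq> b' j" using False by auto
      then show "b k \<noteq> b' k" unfolding k_def by (rule LeastI_ex)
      show "b i = b' i" if "i < k" for i
        using not_less_Least[of i "\<lambda>j. b j \<noteq> b' j"] that by (auto simp: k_def)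
    qed
    define e where "e = 1 / (2 * (real k + 2) ^ 9) / 2 ^ k"
    have e: "e > 0" by (simp add: e_def)
    have "e = 1 / (real k + 2) ^ 9 / 2 ^ Suc k" by (simp add: e_def)
    also have "\<dots> \<le> (slow_weight k - slow_weight (Suc k)) / 2 ^ Suc k"
      by (intro divide_right_mono slow_weight_diff) auto
    also have "\<dots> \<le> \<bar>digit_sum slow_weight b - digit_sum slow_weight b'\<bar>"
      by (rule digit_sum_dist[where b = b and b' = b' and k = k, OF null_weights_slow k(2,1)]) auto
    finally have "e powr \<alpha> \<le> \<bar>digit_sum slow_weight b - digit_sum slow_weight b'\<bar> powr \<alpha>"
      using \<alpha> e by (intro powr_mono2) auto
    then have 1: "C * e powr \<alpha> \<le> C * \<bar>digit_sum slow_weight b - digit_sum slow_weight b'\<bar> powr \<alpha>"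
      using C by (intro mult_left_mono) auto
    have "1 / 2 ^ k = (1 / 2 ^ k) powr \<alpha> * (1 / 2 ^ k) powr (1 - \<alpha>)"
      by (simp flip: powr_add)
    also have "(1 / 2 ^ k) powr (1 - \<alpha>) = r ^ k"
      by (simp add: r_def powr_powr powr_minus_divide[symmetric] powr_divide powr_power flip: powr_realpow)
         (simp add: powr_powr powr_minus_divide[symmetric] algebra_simps)
    also have "(1 / 2 ^ k) powr \<alpha> \<le> 2 * (real k + 2) ^ 9 * e powr \<alpha>"
    proof -
      define p where "p = 2 * (real k + 2) ^ 9"
      have p: "p \<ge> 1" unfolding p_def using one_le_power[of "real k + 2" 9] by linarith
      have "(1 / 2 ^ k) powr \<alpha> = (p * e) powr \<alpha>" using p by (simp add: e_def p_def[symmetric])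
      also have "\<dots> = p powr \<alpha> * e powr \<alpha>" using p e by (simp add: powr_mult)
      also have "\<dots> \<le> p powr 1 * e powr \<alpha>"
        using p \<alpha> by (intro mult_right_mono powr_mono) auto
      finally show ?thesis using p by (simp add: p_def)
    qed
    also have "2 * (real k + 2) ^ 9 * e powr \<alpha> * r ^ k \<le> C * e powr \<alpha>"
      using mult_right_mono[OF C(2)[of k], of "e powr \<alpha>"] by (simp add: mult_ac)
    finally have "1 / 2 ^ k \<le> C * e powr \<alpha>" using r by simp
    then show ?thesis using binary_value_dist[where b = b and b' = b' and k = k, OF k(2)] 1 by linarith
  qed (use C in simp)
  then show ?thesis using that C by (meson less_imp_le)
qed

lemma hoelder_onto_square_digit_points: "hoelder_onto_square (range (digit_point (\<lambda>_. slow_weight)))"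
  unfolding hoelder_onto_square_def
proof (intro allI impI)
  fix \<alpha> :: real assume \<alpha>: "0 < \<alpha> \<and> \<alpha> < 1"
  let ?P = "digit_point (\<lambda>_. slow_weight)"
  let ?v = "digit_sum (\<lambda>_. 1/2)"
  have inj: "inj ?P"
  proof (rule injI)
    fix \<omega> \<omega>' assume eq: "?P \<omega> = ?P \<omega>'"
    show "\<omega> = \<omega>'"
    proof (intro ext, rule ccontr)
      fix i k assume ne: "\<omega> i k \<noteq> \<omega>' i k"
      obtain \<delta> where \<delta>: "\<delta> > 0"
        "\<And>b b'. b k \<noteq> b' k \<Longrightarrow> \<delta> \<le> \<bar>digit_sum slow_weight b - digit_sum slow_weight b'\<bar>"
        using digit_sum_separated[OF null_weights_slow, of k] by blast
      have "0 < \<bar>digit_sum slow_weight (\<omega> i) - digit_sum slow_weight (\<omega>' i)\<bar>"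
        using \<delta>(1) \<delta>(2)[of "\<omega> i" "\<omega>' i", OF ne] by linarith
      moreover have "digit_sum slow_weight (\<omega> i) = digit_sum slow_weight (\<omega>' i)"
        using arg_cong[OF eq, of "\<lambda>x. x $ i"] by (simp add: digit_point_def)
      ultimately show False by simp
    qed
  qed
  \<comment> \<open>Since \<open>?P\<close> is injective, \<open>inv ?P\<close> recovers the digits
    on its range, and they are evaluated anew in binary: the Cantor function in each
    coordinate.\<close>
  define G :: "real^2 \<Rightarrow> real^2" where "G x = (\<chi> i. ?v (inv ?P x i))" for x
  have G: "G (?P \<omega>) = (\<chi> i. ?v (\<omega> i))" for \<omega>
    using inj by (simp add: G_def)
  obtain C where C: "C \<ge> 0"
    "\<And>b b'. \<bar>?v b - ?v b'\<bar> \<le> C * \<bar>digit_sum slow_weight b - digit_sum slow_weight b'\<bar> powr \<alpha>"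
    using cantor_function_hoelder \<alpha> by blast
  have "dist (G (?P \<omega>)) (G (?P \<omega>')) \<le> 2 * C * dist (?P \<omega>) (?P \<omega>') powr \<alpha>" for \<omega> \<omega>'
  proof -
    have "dist (G (?P \<omega>)) (G (?P \<omega>')) \<le> (\<Sum>i\<in>UNIV. \<bar>(G (?P \<omega>) - G (?P \<omega>')) $ i\<bar>)"
      unfolding dist_norm by (rule norm_le_l1_cart)
    also have "\<dots> \<le> (\<Sum>i\<in>(UNIV::2 set). C * dist (?P \<omega>) (?P \<omega>') powr \<alpha>)"
    proof (rule sum_mono)
      fix i :: 2
      have "\<bar>(G (?P \<omega>) - G (?P \<omega>')) $ i\<bar> \<le> C * \<bar>(?P \<omega> - ?P \<omega>') $ i\<bar> powr \<alpha>"
        using C(2)[of "\<omega> i" "\<omega>' i"] unfolding vector_minus_component G by (simp add: digit_point_def)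
      also have "\<dots> \<le> C * dist (?P \<omega>) (?P \<omega>') powr \<alpha>"
        unfolding dist_norm using C(1) \<alpha> component_le_norm_cart[of "?P \<omega> - ?P \<omega>'" i]
        by (intro mult_left_mono powr_mono2) auto
      finally show "\<bar>(G (?P \<omega>) - G (?P \<omega>')) $ i\<bar> \<le> C * dist (?P \<omega>) (?P \<omega>') powr \<alpha>" .
    qed
    finally show ?thesis by simp
  qed
  moreover have "box 0 One \<subseteq> G ` range ?P"
  proof
    fix x :: "real^2" assume "x \<in> box 0 One"
    have x: "0 < x $ i \<and> x $ i < 1" for i
    proof -
      have ax: "axis i 1 \<in> (Basis :: (real^2) set)" by (simp add: axis_in_Basis_iff)
      have "0 \<bullet> (axis i 1 :: real^2) < x \<bullet> axis i 1 \<and> x \<bullet> axis i 1 < One \<bullet> axis i (1::real)"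
        using \<open>x \<in> box 0 One\<close> ax unfolding mem_box by blast
      then show ?thesis using ax by (simp add: cart_eq_inner_axis)
    qed
    have "\<forall>i. \<exists>b. ?v b = x $ i"
      using x by (intro allI binary_value_surj) (auto intro: less_imp_le)
    then obtain \<omega> where "\<And>i. ?v (\<omega> i) = x $ i"
      using choice[of "\<lambda>i b. ?v b = x $ i"] by blast
    then have "G (?P \<omega>) = x" by (simp add: G vec_eq_iff)
    then show "x \<in> G ` range ?P" by blast
  qed
  ultimately show "\<exists>(G :: real^2 \<Rightarrow> real^2) C. (\<forall>x\<in>range ?P. \<forall>y\<in>range ?P. dist (G x) (G y) \<le> C * dist x y powr \<alpha>)
      \<and> box 0 One \<subseteq> G ` range ?P"
    by (intro exI[of _ G] exI[of _ "2 * C"]) simp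
qed

section \<open>Shears\<close>

text \<open>The direction l differs from the coordinate i that is read, which gives zero divergence
  and straight orbits. The amplitude A is recorded because the series are estimated by it; the
  Lipschitz constant, which depends on the gaps, is only asserted to exist.\<close>

definition shear :: "real \<Rightarrow> (real^2 \<Rightarrow> real^2) \<Rightarrow> bool" where
  "shear A g \<longleftrightarrow> (\<exists>i l f L. i \<noteq> l \<and> L-lipschitz_on UNIV f \<and> (\<forall>t. \<bar>f t\<bar> \<le> A) \<and>
     g = (\<lambda>x. f (x $ i) *\<^sub>R axis l 1))"

lemma shear_norm_le: "shear A g \<Longrightarrow> norm (g x) \<le> A"
  by (auto simp: shear_def norm_axis_1)

lemma shear_mono: "shear A g \<Longrightarrow> A \<le> B \<Longrightarrow> shear B g"
  unfolding shear_def using order_trans[of _ A B] by blast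

text \<open>Moving along the field leaves the coordinate that it reads unchanged. Hence x + s g x is
  the flow at time s, and moving by -s undoes it.\<close>

lemma shear_invariant: "shear A g \<Longrightarrow> g (x + s *\<^sub>R g x) = g x"
  by (auto simp: shear_def axis_def)

lemma shear_lipschitz: 
  assumes "shear A g" shows "\<exists>L. L-lipschitz_on UNIV g"
proof -
  obtain i l f L where "i \<noteq> l" and f: "L-lipschitz_on UNIV f" and g: "g = (\<lambda>x. f (x $ i) *\<^sub>R axis l 1)"
    using assms unfolding shear_def by blast
  have "L \<ge> 0" using f lipschitz_on_nonneg by blast
  have "L-lipschitz_on UNIV g"
  proof (rule lipschitz_onI)
    fix x y :: "real^2"
    have "dist (g x) (g y) = dist (f (x $ i)) (f (y $ i))"
      by (simp add: g dist_norm norm_axis_1 flip: scaleR_diff_left)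
    also have "\<dots> \<le> L * dist (x $ i) (y $ i)" using lipschitz_onD[OF f] by simp
    also have "\<dots> \<le> L * dist x y"
      using \<open>L \<ge> 0\<close> by (intro mult_left_mono dist_vec_nth_le)
    finally show "dist (g x) (g y) \<le> L * dist x y" .
  qed fact
  then show ?thesis by blast
qed

lemma shear_flow_lipschitz:
  assumes "shear A g" shows "\<exists>L. L-lipschitz_on UNIV (\<lambda>x. x + s *\<^sub>R g x)"
proof -
  obtain L where "L-lipschitz_on UNIV g" using shear_lipschitz[OF assms] by blast
  then have "(1 + \<bar>s\<bar> * L)-lipschitz_on UNIV (\<lambda>x. x + s *\<^sub>R g x)"
    by (intro lipschitz_intros)
  then show ?thesis by blast
qed

section \<open>Weak divergence of a shear\<close>

lemma integral_lborel_translate: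
  fixes h :: "'a::euclidean_space \<Rightarrow> real"
  assumes "h \<in> borel_measurable borel"
  shows "integral\<^sup>L lborel (\<lambda>x. h (c + x)) = integral\<^sup>L lborel h"
  using integral_distr[of "(+) c" lborel borel h] assms by (simp add: lborel_distr_plus)

lemma integrable_lborel_translate:
  fixes h :: "'a::euclidean_space \<Rightarrow> real"
  assumes "integrable lborel h"
  shows "integrable lborel (\<lambda>x. h (c + x))"
  using integrable_distr[of "(+) c" lborel borel h] assms by (simp add: lborel_distr_plus)

text \<open>Translation invariance along the shear direction annihilates the integrals of the difference quotients of \<open>\<phi>\<close>.\<close>
lemma shear_divergence_free:
  assumes g: "shear A g" and \<phi>: "test_function \<phi>"
  shows "integral UNIV (\<lambda>x. frechet_derivative \<phi> (at x) (g x)) = 0"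
proof -
  obtain i l f L where il: "i \<noteq> l" and f: "L-lipschitz_on UNIV f" and fA: "\<And>t. \<bar>f t\<bar> \<le> A"
    and g_def: "g = (\<lambda>x. f (x $ i) *\<^sub>R axis l 1)"
    using g unfolding shear_def by blast
  define v :: "real^2" where "v = axis l 1"
  define D where "D x = frechet_derivative \<phi> (at x) v" for x
  define K where "K = closure {x. \<phi> x \<noteq> 0}"
  have "Ck (Suc 0) \<phi>" and K: "compact K"
    using \<phi> unfolding test_function_def smooth_fun_def K_def by blast+
  note ck = \<open>Ck (Suc 0) \<phi>\<close>[unfolded Ck.simps]
  have diff: "\<And>x. \<phi> differentiable (at x)" and cont: "continuous_on UNIV \<phi>"
    using ck by blast+
  have contD: "continuous_on UNIV D"
    unfolding D_def using ck by blast
  have der: "(\<phi> has_derivative frechet_derivative \<phi> (at x)) (at x)" for x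
    using diff[of x] by (simp only: frechet_derivative_works)
  have off: "\<phi> x = 0" if "x \<notin> K" for x
    using that closure_subset[of "{x. \<phi> x \<noteq> 0}"] unfolding K_def by auto
  have offD: "D x = 0" if "x \<notin> K" for x
  proof -
    have "open (- K)" using K by (simp add: compact_imp_closed open_Compl)
    then have "(\<phi> has_derivative (\<lambda>_. 0)) (at x)"
      using that off by (intro has_derivative_transform_within_open[OF has_derivative_const[of 0]]) auto
    then have "frechet_derivative \<phi> (at x) = (\<lambda>_. 0)"
      by (rule frechet_derivative_at[symmetric])
    then show ?thesis by (simp add: D_def)
  qed
  have "bounded (D ` K)"
    by (intro compact_imp_bounded compact_continuous_image continuous_on_subset[OF contD] K) auto
  then obtain M where M: "M > 0" "\<And>x. x \<in> K \<Longrightarrow> \<bar>D x\<bar> \<le> M"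
    unfolding bounded_pos by (metis imageI real_norm_def)
  have DM: "\<bar>D x\<bar> \<le> M" for x
    using offD[of x] M(1) M(2)[of x] by (cases "x \<in> K") simp_all
  obtain R where R: "R > 0" "\<And>x. x \<in> K \<Longrightarrow> norm x \<le> R"
    using compact_imp_bounded[OF K] unfolding bounded_pos by blast
  have fcont: "continuous_on UNIV (\<lambda>x::real^2. f (x $ i))"
    by (rule continuous_on_compose2[OF lipschitz_on_continuous_on[OF f] continuous_on_component]) simp_all
  have int_cpt: "integrable lborel h" if "continuous_on UNIV h" "\<And>x. x \<notin> K \<Longrightarrow> h x = 0" for h :: "real^2 \<Rightarrow> real"
  proof -
    have "integrable lborel (\<lambda>x. indicator K x *\<^sub>R h x)"
      using that(1) by (intro borel_integrable_compact K continuous_on_subset[OF that(1)]) auto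
    also have "(\<lambda>x. indicator K x *\<^sub>R h x) = h" using that(2) by (auto simp: indicator_def fun_eq_iff)
    finally show ?thesis .
  qed
  \<comment> \<open>As v has no i-th component, translation along v leaves \<open>f (x $ i)\<close>
    unchanged: the difference quotient of w is f times that of \<phi>, and the merely Lipschitz f is
    never differentiated.\<close>
  define w where "w x = f (x $ i) * \<phi> x" for x
  have wc: "continuous_on UNIV w" unfolding w_def by (intro continuous_intros fcont cont)
  have wi: "integrable lborel w" by (rule int_cpt[OF wc]) (simp add: w_def off)
  have hc: "continuous_on UNIV (\<lambda>x. f (x $ i) * D x)" by (intro continuous_intros fcont contD)
  have hi: "integrable lborel (\<lambda>x. f (x $ i) * D x)" by (rule int_cpt[OF hc]) (simp add: offD)
  define s where "s n = 1 / real (Suc n)" for n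
  have s: "s n > 0" "s n \<le> 1" for n by (auto simp: s_def)
  have s_lim: "s \<longlonglongrightarrow> 0" unfolding s_def by (rule LIMSEQ_Suc) (rule lim_1_over_n)
  define u where "u n x = (w (s n *\<^sub>R v + x) - w x) / s n" for n x
  have vi: "v $ i = 0" using il by (simp add: v_def axis_def)
  have u_alt: "u n x = f (x $ i) * ((\<phi> (x + s n *\<^sub>R v) - \<phi> x) / s n)" for n x
    by (simp add: u_def w_def vi add.commute right_diff_distrib diff_divide_distrib)
  have u0: "integral\<^sup>L lborel (u n) = 0" for n
  proof -
    have "integral\<^sup>L lborel (\<lambda>x. w (s n *\<^sub>R v + x) - w x) = 0"
      using integral_lborel_translate[of w "s n *\<^sub>R v"] wc
      by (subst Bochner_Integration.integral_diff) (auto intro!: integrable_lborel_translate wi borel_measurable_continuous_onI)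
    then show ?thesis by (simp add: u_def[abs_def])
  qed
  have line: "((\<lambda>r. \<phi> (x + r *\<^sub>R v)) has_real_derivative D (x + r *\<^sub>R v)) (at r)" for x r
  proof -
    have "((\<lambda>r. x + r *\<^sub>R v) has_derivative (\<lambda>h. h *\<^sub>R v)) (at r)"
      by (auto intro!: derivative_eq_intros)
    from has_derivative_compose[OF this der]
    have 1: "((\<lambda>r. \<phi> (x + r *\<^sub>R v)) has_derivative (\<lambda>h. frechet_derivative \<phi> (at (x + r *\<^sub>R v)) (h *\<^sub>R v))) (at r)" .
    have "frechet_derivative \<phi> (at (x + r *\<^sub>R v)) (h *\<^sub>R v) = D (x + r *\<^sub>R v) * h" for h
      using linear_scale[OF has_derivative_linear[OF der]] by (simp add: D_def mult.commute)
    with 1 show ?thesis by (simp add: has_field_derivative_def)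
  qed
  have "(\<lambda>n. integral\<^sup>L lborel (u n)) \<longlonglongrightarrow> integral\<^sup>L lborel (\<lambda>x. f (x $ i) * D x)"
  proof (rule integral_dominated_convergence)
    show "(\<lambda>x. f (x $ i) * D x) \<in> borel_measurable lborel"
      using hi by (rule borel_measurable_integrable)
    show "u n \<in> borel_measurable lborel" for n
      unfolding u_def[abs_def] by (intro borel_measurable_integrable) (auto intro!: integrable_lborel_translate wi)
    \<comment> \<open>By the mean value theorem the quotients are at most A M, and since the steps
      are at most 1 they vanish outside the ball of radius R + 1.\<close>
    show "integrable lborel (\<lambda>x::real^2. indicator (cball 0 (R + 1)) x *\<^sub>R (A * M))"
      by (intro borel_integrable_compact) auto
    show "AE x in lborel. (\<lambda>n. u n x) \<longlonglongrightarrow> f (x $ i) * D x"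
    proof (rule AE_I2)
      fix x
      have "((\<lambda>h. (\<phi> (x + (0 + h) *\<^sub>R v) - \<phi> (x + 0 *\<^sub>R v)) / h) \<longlongrightarrow> D (x + 0 *\<^sub>R v)) (at 0)"
        using line[of x 0] unfolding DERIV_def .
      then have "((\<lambda>h. (\<phi> (x + h *\<^sub>R v) - \<phi> x) / h) \<longlongrightarrow> D x) (at 0)" by simp
      moreover have "filterlim s (at 0) sequentially"
        using s_lim s(1) by (intro filterlim_atI) (auto simp: less_imp_neq[symmetric])
      ultimately have "(\<lambda>n. (\<phi> (x + s n *\<^sub>R v) - \<phi> x) / s n) \<longlonglongrightarrow> D x"
        by (rule filterlim_compose)
      then show "(\<lambda>n. u n x) \<longlonglongrightarrow> f (x $ i) * D x"
        unfolding u_alt by (intro tendsto_mult tendsto_const)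
    qed
    show "AE x in lborel. norm (u n x) \<le> indicator (cball 0 (R + 1)) x *\<^sub>R (A * M)" for n
    proof (rule AE_I2)
      fix x
      show "norm (u n x) \<le> indicator (cball 0 (R + 1)) x *\<^sub>R (A * M)"
      proof (cases "norm x \<le> R + 1")
        case True
        obtain z where z: "\<phi> (x + s n *\<^sub>R v) - \<phi> (x + 0 *\<^sub>R v) = (s n - 0) * D (x + z *\<^sub>R v)"
          using MVT2[OF s(1)[of n] line[of x]] by blast
        then have "u n x = f (x $ i) * D (x + z *\<^sub>R v)"
          using s(1)[of n] by (simp add: u_alt)
        moreover have "\<bar>f (x $ i) * D (x + z *\<^sub>R v)\<bar> \<le> A * M"
          unfolding abs_mult by (rule mult_mono[OF fA DM order_trans[OF abs_ge_zero fA] abs_ge_zero])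
        ultimately show ?thesis using True by simp
      next
        case False
        have "norm (s n *\<^sub>R v) \<le> 1" using s[of n] by (simp add: v_def norm_axis_1)
        moreover have "norm x \<le> norm (x + s n *\<^sub>R v) + norm (s n *\<^sub>R v)"
          using norm_triangle_ineq4[of "x + s n *\<^sub>R v" "s n *\<^sub>R v"] by simp
        ultimately have "\<not> norm x \<le> R" "\<not> norm (x + s n *\<^sub>R v) \<le> R"
          using False by linarith+
        then have "x \<notin> K" "x + s n *\<^sub>R v \<notin> K"
          using R(2) by blast+
        then show ?thesis using False by (simp add: u_alt off)
      qed
    qed
  qed
  then have "integral\<^sup>L lborel (\<lambda>x. f (x $ i) * D x) = 0"
    unfolding u0 by (simp add: LIMSEQ_const_iff)
  moreover have "frechet_derivative \<phi> (at x) (g x) = f (x $ i) * D x" for x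
    using linear_scale[OF has_derivative_linear[OF der]] by (simp add: D_def g_def v_def)
  ultimately show ?thesis
    using integral_lborel[OF hi] by simp
qed

section \<open>Lowering one weight by shears\<close>

lemma shear_two_valued:
  fixes P :: "'a \<Rightarrow> real^2"
  assumes \<delta>: "\<delta> > 0" "\<And>c c'. Q c \<Longrightarrow> \<not> Q c' \<Longrightarrow> \<delta> \<le> \<bar>P c $ i - P c' $ i\<bar>"
    and il: "i \<noteq> l" and w: "\<bar>w\<bar> \<le> W"
  obtains g where "shear W g" "\<And>c. g (P c) = (if Q c then w else 0) *\<^sub>R axis l 1"
proof -
  define B where "B = {P c $ i |c. \<not> Q c}"
  \<comment> \<open>A cutoff that is 0 on B and full at distance \<delta> from it, whence the
    Lipschitz constant |w| / \<delta>. As \<open>infdist\<close> to the empty set is 0, the case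
    that all indices satisfy Q needs the value w explicitly.\<close>
  define f where "f t = (if B = {} then w else w * min 1 (infdist t B / \<delta>))" for t
  have "(\<bar>w\<bar> * (1 / \<delta>))-lipschitz_on UNIV f"
  proof (rule lipschitz_onI)
    fix x y
    have "\<bar>min 1 (infdist x B / \<delta>) - min 1 (infdist y B / \<delta>)\<bar> \<le> \<bar>infdist x B / \<delta> - infdist y B / \<delta>\<bar>"
      by linarith
    also have "\<dots> = 1 / \<delta> * \<bar>infdist x B - infdist y B\<bar>"
      using \<delta> by (simp add: abs_divide flip: diff_divide_distrib)
    also have "\<dots> \<le> 1 / \<delta> * dist x y"
      using \<delta> by (intro mult_left_mono infdist_triangle_abs) auto
    finally have "\<bar>w\<bar> * \<bar>min 1 (infdist x B / \<delta>) - min 1 (infdist y B / \<delta>)\<bar> \<le> \<bar>w\<bar> * (1 / \<delta> * dist x y)"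
      by (rule mult_left_mono) simp
    then show "dist (f x) (f y) \<le> \<bar>w\<bar> * (1 / \<delta>) * dist x y"
      using \<delta> by (auto simp: f_def dist_real_def abs_mult mult.assoc simp flip: right_diff_distrib)
  qed (use \<delta> in auto)
  moreover have "\<bar>f t\<bar> \<le> W" for t
  proof -
    have "0 \<le> min 1 (infdist t B / \<delta>)" "min 1 (infdist t B / \<delta>) \<le> 1"
      using \<delta> infdist_nonneg[of t B] by auto
    then have "\<bar>w\<bar> * \<bar>min 1 (infdist t B / \<delta>)\<bar> \<le> \<bar>w\<bar> * 1" by (intro mult_left_mono) auto
    then show ?thesis using w by (simp add: f_def abs_mult)
  qed
  ultimately have "shear W (\<lambda>x. f (x $ i) *\<^sub>R axis l 1)"
    unfolding shear_def using il by blast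
  moreover have "f (P c $ i) = (if Q c then w else 0)" for c
  proof (cases "Q c")
    case True
    have "\<delta> \<le> infdist (P c $ i) B" if "B \<noteq> {}"
      unfolding infdist_notempty[OF that] using that \<delta>(2)[OF True]
      by (intro cINF_greatest) (auto simp: B_def dist_real_def)
    then show ?thesis using True \<delta>(1) by (auto simp: f_def)
  next
    case False
    then have "P c $ i \<in> B" by (auto simp: B_def)
    then show ?thesis using False by (auto simp: f_def)
  qed
  ultimately show ?thesis by (intro that) auto
qed

abbreviation apply_shears :: "(real^2 \<Rightarrow> real^2) list \<Rightarrow> real^2 \<Rightarrow> real^2" where
  "apply_shears \<equiv> fold (\<lambda>g x. x + g x)"

text \<open>The points with a nonzero \<open>k\<close>th digit are moved aside in direction \<open>l\<close>, where a shear in direction \<open>i\<close> acts on them alone, and moved back.\<close>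
lemma change_level_coordinate:
  fixes i l :: 2
  assumes il: "i \<noteq> l" and c: "null_weights (c i)" "null_weights (c l)" and c': "null_weights ((c i)(k := x))"
    and M: "c i 0 \<le> M" "c l 0 \<le> M" and x: "x \<le> c i k"
  shows "\<exists>gs. length gs = 3 \<and> (\<forall>g\<in>set gs. shear (4 * M) g) \<and>
    (\<forall>\<omega>. apply_shears gs (digit_point c \<omega>) = digit_point (c(i := (c i)(k := x))) \<omega>)"
proof -
  have M0: "M > 0" using null_weights_pos[OF c(1), of 0] M by linarith
  have cases2: "j = i \<or> j = l" for j :: 2
    using il by (metis exhaust_2)
  define Q where "Q \<omega> \<longleftrightarrow> \<omega> i k" for \<omega> :: "2 \<Rightarrow> nat \<Rightarrow> bool"
  define P0 where "P0 = digit_point c"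
  \<comment> \<open>Coordinate l takes values in [0, 2 M], so the offset 4 M leaves a gap of at
    least 2 M between the two classes, which a shear in direction i can read. The same 4 M bounds
    all three amplitudes.\<close>
  define P1 where "P1 \<omega> = P0 \<omega> + (if Q \<omega> then 4 * M else 0) *\<^sub>R axis l 1" for \<omega>
  define P3 where "P3 = digit_point (c(i := (c i)(k := x)))"
  define P2 where "P2 \<omega> = P3 \<omega> + (if Q \<omega> then 4 * M else 0) *\<^sub>R axis l 1" for \<omega>
  obtain \<delta> where \<delta>: "\<delta> > 0" "\<And>b b'. b k \<noteq> b' k \<Longrightarrow> \<delta> \<le> \<bar>digit_sum (c i) b - digit_sum (c i) b'\<bar>"
    using digit_sum_separated[OF c(1), of k] by blast
  obtain g1 where g1: "shear (4 * M) g1" "\<And>\<omega>. g1 (P0 \<omega>) = (if Q \<omega> then 4 * M else 0) *\<^sub>R axis l 1"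
  proof (rule shear_two_valued[of \<delta> Q P0 i l "4 * M" "4 * M"])
    show "\<delta> \<le> \<bar>P0 \<omega> $ i - P0 \<omega>' $ i\<bar>" if "Q \<omega>" "\<not> Q \<omega>'" for \<omega> \<omega>'
      using \<delta>(2)[of "\<omega> i" "\<omega>' i"] that by (simp add: P0_def digit_point_def Q_def)
  qed (use \<delta> il M0 in auto)
  obtain g2 where g2: "shear (4 * M) g2" "\<And>\<omega>. g2 (P1 \<omega>) = (if Q \<omega> then (x - c i k) / 2 ^ k else 0) *\<^sub>R axis i 1"
  proof (rule shear_two_valued[of "2 * M" Q P1 l i "(x - c i k) / 2 ^ k" "4 * M"])
    show "2 * M \<le> \<bar>P1 \<omega> $ l - P1 \<omega>' $ l\<bar>" if "Q \<omega>" "\<not> Q \<omega>'" for \<omega> \<omega>'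
    proof -
      have "0 \<le> digit_sum (c l) (\<omega> l)" "digit_sum (c l) (\<omega>' l) \<le> 2 * M"
        using digit_sum_bounds[OF c(2), of "\<omega> l"] digit_sum_bounds[OF c(2), of "\<omega>' l"] M(2) by linarith+
      then show ?thesis using that by (simp add: P1_def P0_def digit_point_def)
    qed
    have "x > 0" using null_weights_pos[OF c', of k] by simp
    then have "\<bar>x - c i k\<bar> \<le> M" using x null_weights_le[OF c(1), of 0 k] M by simp
    moreover have "\<bar>x - c i k\<bar> / 2 ^ k \<le> \<bar>x - c i k\<bar> / 1"
      by (intro divide_left_mono) auto
    ultimately show "\<bar>(x - c i k) / 2 ^ k\<bar> \<le> 4 * M" using M0 by (simp add: abs_divide)
  qed (use M0 il in auto)
  \<comment> \<open>To undo the offset, the digit is read off coordinate i once more, now with the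
    lowered weight; hence the new weights must separate it as well.\<close>
  obtain \<delta>' where \<delta>': "\<delta>' > 0" "\<And>b b'. b k \<noteq> b' k \<Longrightarrow> \<delta>' \<le> \<bar>digit_sum ((c i)(k := x)) b - digit_sum ((c i)(k := x)) b'\<bar>"
    using digit_sum_separated[OF c', of k] by blast
  obtain g3 where g3: "shear (4 * M) g3" "\<And>\<omega>. g3 (P2 \<omega>) = (if Q \<omega> then - 4 * M else 0) *\<^sub>R axis l 1"
  proof (rule shear_two_valued[of \<delta>' Q P2 i l "- 4 * M" "4 * M"])
    show "\<delta>' \<le> \<bar>P2 \<omega> $ i - P2 \<omega>' $ i\<bar>" if "Q \<omega>" "\<not> Q \<omega>'" for \<omega> \<omega>'
      using \<delta>'(2)[of "\<omega> i" "\<omega>' i"] that il by (simp add: P2_def P3_def digit_point_def Q_def axis_def)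
  qed (use \<delta>' il M0 in auto)
  have s1: "P0 \<omega> + g1 (P0 \<omega>) = P1 \<omega>" for \<omega> by (simp add: g1 P1_def)
  have s2: "P1 \<omega> + g2 (P1 \<omega>) = P2 \<omega>" for \<omega>
  proof -
    have "(P1 \<omega> + g2 (P1 \<omega>)) $ j = P2 \<omega> $ j" for j
      using cases2[of j] il digit_sum_fun_upd[OF c(1) c', of "\<omega> i"]
      by (auto simp: g2(2)) (auto simp: P1_def P2_def P0_def P3_def digit_point_def Q_def axis_def)
    then show ?thesis by (simp add: vec_eq_iff)
  qed
  have s3: "P2 \<omega> + g3 (P2 \<omega>) = P3 \<omega>" for \<omega>
    by (simp add: g3(2)) (simp add: P2_def)
  show ?thesis
    using g1(1) g2(1) g3(1) s1 s2 s3
    by (intro exI[of _ "[g1, g2, g3]"]) (simp flip: P0_def P3_def)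
qed

text \<open>The coordinates are treated one after the other, with three shears each. The amplitude
  bound persists in the second half because lowering keeps the leading weight at most c 0.\<close>

lemma change_level:
  assumes c: "null_weights c" and c': "null_weights (c(k := x))" and x: "x \<le> c k"
  shows "\<exists>gs. length gs = 6 \<and> (\<forall>g\<in>set gs. shear (4 * c 0) g) \<and>
    (\<forall>\<omega>. apply_shears gs (digit_point (\<lambda>_. c) \<omega>) = digit_point (\<lambda>_. c(k := x)) \<omega>)"
proof -
  let ?c1 = "(\<lambda>_::2. c)(1 := c(k := x))"
  obtain gs where gs: "length gs = 3" "\<forall>g\<in>set gs. shear (4 * c 0) g"
    "\<And>\<omega>. apply_shears gs (digit_point (\<lambda>_. c) \<omega>) = digit_point ?c1 \<omega>"
    using change_level_coordinate[of 1 2 "\<lambda>_. c" k x "c 0"] c c' x by auto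
  have "(c(k := x)) 0 \<le> c 0" using x by auto
  then obtain gs' where gs': "length gs' = 3" "\<forall>g\<in>set gs'. shear (4 * c 0) g"
    "\<And>\<omega>. apply_shears gs' (digit_point ?c1 \<omega>) = digit_point (?c1(2 := c(k := x))) \<omega>"
    using change_level_coordinate[of 2 1 ?c1 k x "c 0"] c c' x by auto
  have "?c1(2 := c(k := x)) = (\<lambda>_. c(k := x))"
    using exhaust_2 by (fastforce simp: fun_eq_iff)
  then show ?thesis
    using gs gs' by (intro exI[of _ "gs @ gs'"]) auto
qed

section \<open>Schedule of the weight reductions\<close>

text \<open>The steps run through the pairs \<open>(a, b)\<close> along antidiagonals.  During diagonal \<open>s = a + b\<close> the weights at
  the levels \<open>b = s, \<dots>, 0\<close> are lowered in this order from \<open>slow_weight s\<close> to \<open>slow_weight (s + 1)\<close>,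
  so that the weights remain monotone.\<close>
definition scheduled_weight :: "nat \<Rightarrow> nat \<Rightarrow> real" where
  "scheduled_weight j k = (case prod_decode j of (a, b) \<Rightarrow>
     slow_weight (max k (if k \<le> b then a + b else Suc (a + b))))"

lemma prod_decode_Suc:
  assumes "prod_decode j = (a, b)"
  shows "prod_decode (Suc j) = (case b of 0 \<Rightarrow> (0, Suc a) | Suc b' \<Rightarrow> (Suc a, b'))"
proof -
  have "Suc j = prod_encode (case b of 0 \<Rightarrow> (0, Suc a) | Suc b' \<Rightarrow> (Suc a, b'))"
    using prod_decode_inverse[of j] assms by (auto simp: prod_encode_def split: nat.split)
  then show ?thesis by (simp only: prod_encode_inverse)
qed

lemma prod_decode_bound:
  assumes "prod_decode j = (a, b)"
  shows "Suc j \<le> (Suc (a + b))\<^sup>2"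
proof -
  have "j = triangle (a + b) + a"
    using prod_decode_inverse[of j] assms by (simp add: prod_encode_def)
  moreover have "triangle (a + b) \<le> (a + b) * Suc (a + b)"
    by (simp add: triangle_def)
  ultimately show ?thesis by (simp add: power2_eq_square)
qed

lemma scheduled_weight_0: "scheduled_weight 0 = slow_weight"
proof -
  have "prod_decode 0 = (0, 0)" using prod_encode_inverse[of "(0, 0)"] by (simp add: prod_encode_def)
  then show ?thesis by (auto simp: scheduled_weight_def fun_eq_iff max_def intro!: arg_cong[of _ _ slow_weight])
qed

text \<open>The scheduled weights are \<open>slow_weight\<close> reindexed by a map m with m k \<ge>
  k, so the limit 0 carries over. Lowering the higher levels of a diagonal first is what keeps m
  monotone.\<close>

lemma null_weights_scheduled: "null_weights (scheduled_weight j)"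
proof -
  obtain a b where ab: "prod_decode j = (a, b)" by fastforce
  define m where "m k = max k (if k \<le> b then a + b else Suc (a + b))" for k
  have eq: "scheduled_weight j k = slow_weight (m k)" for k
    by (simp add: scheduled_weight_def ab m_def)
  have "mono m" by (auto simp: mono_def m_def)
  moreover have "filterlim m at_top sequentially"
    by (rule filterlim_at_top_mono[OF filterlim_ident]) (simp add: m_def)
  ultimately show ?thesis
    using null_weights_slow filterlim_compose[of slow_weight "nhds 0" sequentially m]
    unfolding null_weights_def eq[abs_def] decseq_def mono_def by blast
qed

text \<open>At the end of a diagonal, b = 0, the description passes to the next one, in which all
  levels up to s + 1 have index s + 1, where s = a + b. This agrees with level 0 having been lowered
  last.\<close>

lemma scheduled_weight_Suc:
  assumes "prod_decode j = (a, b)"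
  shows "scheduled_weight (Suc j) = (scheduled_weight j)(b := slow_weight (Suc (a + b)))"
    and "slow_weight (Suc (a + b)) \<le> scheduled_weight j b"
proof -
  show "scheduled_weight (Suc j) = (scheduled_weight j)(b := slow_weight (Suc (a + b)))"
    using prod_decode_Suc[OF assms] assms
    by (auto simp: scheduled_weight_def fun_eq_iff max_def split: nat.split intro!: arg_cong[of _ _ slow_weight])
  have "scheduled_weight j b = slow_weight (a + b)" by (simp add: scheduled_weight_def assms)
  then show "slow_weight (Suc (a + b)) \<le> scheduled_weight j b"
    using null_weights_le[OF null_weights_slow] by simp
qed

text \<open>Level 0 carries the largest weight and so controls the size of the whole set. On
  diagonal s the step number satisfies j + 1 \<le> (s + 1)^2, which turns the exponent 8 into
  4.\<close>

lemma scheduled_weight_top: "scheduled_weight j 0 \<le> 1 / (real j + 1) ^ 4"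
proof -
  obtain a b where ab: "prod_decode j = (a, b)" by fastforce
  have "real (Suc j) \<le> real ((Suc (a + b))\<^sup>2)"
    using prod_decode_bound[OF ab] of_nat_le_iff by blast
  then have "real j + 1 \<le> (real (a + b) + 1)\<^sup>2" by (simp add: add_ac)
  then have "(real j + 1) ^ 4 \<le> ((real (a + b) + 1)\<^sup>2) ^ 4" by (intro power_mono) auto
  also have "\<dots> = (real (a + b) + 1) ^ 8" by (simp flip: power_mult)
  finally have "1 / (real (a + b) + 1) ^ 8 \<le> 1 / (real j + 1) ^ 4"
    by (intro divide_left_mono) auto
  then show ?thesis by (simp add: scheduled_weight_def ab slow_weight_def)
qed

primrec shear_iterate :: "(nat \<Rightarrow> real^2 \<Rightarrow> real^2) \<Rightarrow> nat \<Rightarrow> real^2 \<Rightarrow> real^2" where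
  "shear_iterate g 0 x = x"
| "shear_iterate g (Suc n) x = shear_iterate g n x + g n (shear_iterate g n x)"

text \<open>Norms are bounded only after complete blocks of six shears, since in between points are
  held aside; these multiples suffice because the whole sequence of iterates will converge. The
  factor (n + 1)^2 is the order of the reciprocal duration of stage n.\<close>

lemma collapsing_shears:
  "\<exists>g A r. (\<forall>n. shear (A n) (g n)) \<and> summable (\<lambda>n. (real n + 1)\<^sup>2 * A n) \<and> r \<longlonglongrightarrow> 0 \<and>
    (\<forall>j. \<forall>x\<in>range (digit_point (\<lambda>_. slow_weight)). norm (shear_iterate g (6 * j) x) \<le> r j)"
proof -
  let ?P = "\<lambda>j. digit_point (\<lambda>_. scheduled_weight j)"
  define good where "good j gs \<longleftrightarrow> length gs = 6 \<and> (\<forall>g\<in>set gs. shear (4 * scheduled_weight j 0) g) \<and>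
    (\<forall>\<omega>. apply_shears gs (?P j \<omega>) = ?P (Suc j) \<omega>)" for j gs
  have "\<forall>j. \<exists>gs. good j gs"
  proof
    fix j
    obtain a b where ab: "prod_decode j = (a, b)" by fastforce
    show "\<exists>gs. good j gs"
      using change_level[OF null_weights_scheduled, of j b] null_weights_scheduled[of "Suc j"]
        scheduled_weight_Suc[OF ab] by (simp add: good_def)
  qed
  then obtain gs where "\<forall>j. good j (gs j)" by (rule choice[THEN exE])
  then have gs: "\<And>j. length (gs j) = 6" "\<And>j g. g \<in> set (gs j) \<Longrightarrow> shear (4 * scheduled_weight j 0) g"
    "\<And>j \<omega>. apply_shears (gs j) (?P j \<omega>) = ?P (Suc j) \<omega>"
    by (simp_all add: good_def)
  define g where "g n = gs (n div 6) ! (n mod 6)" for n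
  define A where "A n = 4 * (1 / (real (n div 6) + 1) ^ 4)" for n
  show ?thesis
  proof (rule exI[of _ g], rule exI[of _ A], rule exI[of _ "\<lambda>j. 4 * (1 / (real j + 1) ^ 4)"],
      intro conjI allI ballI)
    show "shear (A n) (g n)" for n
    proof (rule shear_mono)
      show "shear (4 * scheduled_weight (n div 6) 0) (g n)"
        unfolding g_def by (intro gs(2) nth_mem) (simp add: gs(1))
      show "4 * scheduled_weight (n div 6) 0 \<le> A n"
        unfolding A_def by (intro mult_left_mono scheduled_weight_top) auto
    qed
    show "summable (\<lambda>n. (real n + 1)\<^sup>2 * A n)"
    proof (rule summable_comparison_test)
      have "summable (\<lambda>n. inverse (real (Suc n) ^ 2))"
        using inverse_power_summable[of 2] by (subst summable_Suc_iff) auto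
      then show "summable (\<lambda>n. 4 * 6 ^ 4 * inverse (real (Suc n) ^ 2))" by (rule summable_mult)
      have "norm ((real n + 1)\<^sup>2 * A n) \<le> 4 * 6 ^ 4 * inverse (real (Suc n) ^ 2)" for n
      proof -
        \<comment> \<open>The block number is comparable with n / 6, namely n + 1 \<le> 6 (n div 6 +
          1); this costs the factor 6^4.\<close>
        define p q where "p = real n + 1" and "q = real (n div 6) + 1"
        have q: "q > 0" "p > 0" by (auto simp: p_def q_def)
        have "n < 6 + 6 * (n div 6)" by (rule dividend_less_times_div) simp
        then have "p \<le> 6 * q" unfolding p_def q_def by simp
        then have "p ^ 4 \<le> (6 * q) ^ 4" using q by (intro power_mono) auto
        then have "p ^ 2 * p ^ 2 \<le> 6 ^ 4 * q ^ 4"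
          by (simp only: power_mult_distrib) (simp flip: power_add)
        then have "p ^ 2 * (4 * (1 / q ^ 4)) \<le> 4 * 6 ^ 4 * inverse (p ^ 2)"
          using q by (simp add: field_simps)
        moreover have "real (Suc n) = p" by (simp add: p_def)
        ultimately show ?thesis using q unfolding A_def by (simp add: p_def q_def add.commute)
      qed
      then show "\<exists>N. \<forall>n\<ge>N. norm ((real n + 1)\<^sup>2 * A n) \<le> 4 * 6 ^ 4 * inverse (real (Suc n) ^ 2)" by blast
    qed
    show "(\<lambda>j. 4 * (1 / (real j + 1) ^ 4)) \<longlonglongrightarrow> 0" by real_asymp
    fix j x assume "x \<in> range (digit_point (\<lambda>_. slow_weight))"
    then obtain \<omega> where x: "x = ?P 0 \<omega>" by (auto simp: scheduled_weight_0)
    have iter: "shear_iterate g (6 * j + i) y = apply_shears (take i (gs j)) (shear_iterate g (6 * j) y)"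
      if "i \<le> 6" for i j y
      using that
    proof (induction i)
      case (Suc i)
      then have "g (6 * j + i) = gs j ! i" by (simp add: g_def)
      then show ?case using Suc gs(1)[of j] by (simp add: take_Suc_conv_app_nth)
    qed simp
    have "shear_iterate g (6 * j) x = ?P j \<omega>"
    proof (induction j)
      case (Suc j)
      have "shear_iterate g (6 * Suc j) x = shear_iterate g (6 * j + 6) x" by (simp add: add.commute)
      also have "\<dots> = ?P (Suc j) \<omega>" using iter[of 6 j x] Suc gs(1)[of j] gs(3) by simp
      finally show ?case .
    qed (simp add: x)
    moreover have "norm (?P j \<omega>) \<le> (\<Sum>i\<in>UNIV. \<bar>?P j \<omega> $ i\<bar>)" by (rule norm_le_l1_cart)
    moreover have "\<dots> \<le> (\<Sum>i\<in>(UNIV :: 2 set). 2 * scheduled_weight j 0)"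
      using digit_sum_bounds[OF null_weights_scheduled] by (intro sum_mono) (simp add: digit_point_def)
    ultimately show "norm (shear_iterate g (6 * j) x) \<le> 4 * (1 / (real j + 1) ^ 4)"
      using scheduled_weight_top[of j] by simp
  qed
qed

section \<open>Concatenation of infinitely many shears\<close>

lemma has_vector_derivative_series:
  fixes f :: "nat \<Rightarrow> real \<Rightarrow> 'a::banach"
  assumes S: "convex S" "x \<in> S"
    and f: "\<And>n x. x \<in> S \<Longrightarrow> (f n has_vector_derivative f' n x) (at x within S)"
    and lim: "uniform_limit S (\<lambda>n x. \<Sum>i<n. f' i x) g' sequentially"
    and sum: "\<And>x. x \<in> S \<Longrightarrow> (\<lambda>n. f n x) sums g x"
  shows "(g has_vector_derivative g' x) (at x within S)"
proof -
  have "\<exists>h. \<forall>x\<in>S. (\<lambda>n. f n x) sums (h x) \<and> (h has_derivative (\<lambda>r. r *\<^sub>R g' x)) (at x within S)"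
  proof (rule has_derivative_series[where f = f and f' = "\<lambda>n x r. r *\<^sub>R f' n x" and g' = "\<lambda>x r. r *\<^sub>R g' x"
        and x = x and l = "g x", OF S(1) _ _ S(2) sum[OF S(2)]])
    show "(f n has_derivative (\<lambda>r. r *\<^sub>R f' n x)) (at x within S)" if "x \<in> S" for n x
      using f[OF that] by (simp add: has_vector_derivative_def)
    fix e :: real assume "e > 0"
    from uniform_limitD[OF lim this]
    show "\<forall>\<^sub>F n in sequentially. \<forall>x\<in>S. \<forall>h. norm ((\<Sum>i<n. h *\<^sub>R f' i x) - h *\<^sub>R g' x) \<le> e * norm h"
    proof eventually_elim
      case (elim n)
      show ?case
      proof (intro ballI allI)
        fix x h assume "x \<in> S"
        have "norm ((\<Sum>i<n. h *\<^sub>R f' i x) - h *\<^sub>R g' x) = \<bar>h\<bar> * dist (\<Sum>i<n. f' i x) (g' x)"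
          by (simp add: dist_norm flip: scaleR_sum_right scaleR_diff_right)
        also have "\<dots> \<le> \<bar>h\<bar> * e"
          using elim \<open>x \<in> S\<close> by (intro mult_left_mono) (auto intro: less_imp_le)
        finally show "norm ((\<Sum>i<n. h *\<^sub>R f' i x) - h *\<^sub>R g' x) \<le> e * norm h"
          by (simp add: mult.commute)
      qed
    qed
  qed
  then obtain h where h: "\<And>x. x \<in> S \<Longrightarrow> (\<lambda>n. f n x) sums (h x)"
    "(h has_vector_derivative g' x) (at x within S)"
    using S(2) unfolding has_vector_derivative_def by blast
  have "h y = g y" if "y \<in> S" for y
    using sums_unique2[OF h(1)[OF that] sum[OF that]] .
  then show ?thesis
    using has_vector_derivative_transform[OF S(2) _ h(2)] by auto
qed

lemma uniform_limit_uniformly_continuous_on: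
  fixes f :: "nat \<Rightarrow> 'a::metric_space \<Rightarrow> 'b::metric_space"
  assumes lim: "uniform_limit S f g sequentially" and f: "\<And>n. uniformly_continuous_on S (f n)"
  shows "uniformly_continuous_on S g"
  unfolding uniformly_continuous_on_def
proof (intro allI impI)
  fix e :: real assume "e > 0"
  then have "e / 3 > 0" by simp
  from uniform_limitD[OF lim this] obtain n where n: "\<forall>x\<in>S. dist (f n x) (g x) < e / 3"
    using eventually_happens'[OF sequentially_bot] by blast
  obtain d where d: "d > 0" "\<And>x y. x \<in> S \<Longrightarrow> y \<in> S \<Longrightarrow> dist y x < d \<Longrightarrow> dist (f n y) (f n x) < e / 3"
    using f[of n] \<open>e / 3 > 0\<close> unfolding uniformly_continuous_on_def by metis
  have "dist (g y) (g x) < e" if "x \<in> S" "y \<in> S" "dist y x < d" for x y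
  proof -
    have "dist (f n x) (g x) < e / 3" "dist (f n y) (g y) < e / 3" "dist (f n y) (f n x) < e / 3"
      using n d(2) that by blast+
    then show ?thesis by metric
  qed
  then show "\<exists>d>0. \<forall>x\<in>S. \<forall>x'\<in>S. dist x' x < d \<longrightarrow> dist (g x') (g x) < e"
    using d(1) by blast
qed

section \<open>Time profile of a single stage\<close>

definition hat :: "real \<Rightarrow> real" where
  "hat s = 4 * (max 0 s - 2 * max 0 (s - 1/2) + max 0 (s - 1))"

text \<open>The primitive of \<open>hat\<close>, which is the tent of height 2 over [0, 1]. The tent
  vanishes at both ends, so consecutive stages fit together continuously, and its integral 1
  executes each shear exactly once. Squares of positive parts give one C^1 formula for all
  times.\<close>

definition ramp :: "real \<Rightarrow> real" where
  "ramp s = 2 * ((max 0 s)\<^sup>2 - 2 * (max 0 (s - 1/2))\<^sup>2 + (max 0 (s - 1))\<^sup>2)"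

lemma pos_part_square_deriv: "((\<lambda>s. (max 0 s)\<^sup>2) has_real_derivative 2 * max 0 s) (at s)" for s :: real
proof -
  consider "s < 0" | "s = 0" | "s > 0" by linarith
  then show ?thesis
  proof cases
    case 1
    have "((\<lambda>s. 0::real) has_real_derivative 2 * max 0 s) (at s)" using 1 by simp
    then show ?thesis
      by (rule has_field_derivative_transform_within[where d = "- s"]) (use 1 in \<open>auto simp: dist_real_def\<close>)
  next
    case 2
    have "(\<lambda>h::real. max 0 h) \<midarrow>0\<rightarrow> max 0 0" by (intro tendsto_max tendsto_const tendsto_ident_at)
    moreover have "eventually (\<lambda>h::real. max 0 h = (max 0 (0 + h))\<^sup>2 / h) (at 0)"
      unfolding eventually_at by (intro exI[of _ 1]) (auto simp: max_def power2_eq_square)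
    ultimately have "(\<lambda>h::real. (max 0 (0 + h))\<^sup>2 / h) \<midarrow>0\<rightarrow> 0"
      by (simp add: Lim_transform_eventually)
    then show ?thesis using 2 by (simp add: DERIV_def)
  next
    case 3
    have "((\<lambda>s. s\<^sup>2) has_real_derivative 2 * max 0 s) (at s)"
      using 3 by (auto intro!: derivative_eq_intros)
    then show ?thesis
      by (rule has_field_derivative_transform_within[where d = s]) (use 3 in \<open>auto simp: dist_real_def\<close>)
  qed
qed

lemma ramp_deriv: "(ramp has_real_derivative hat s) (at s)"
proof -
  have *: "((\<lambda>s. (max 0 (s - a))\<^sup>2) has_real_derivative 2 * max 0 (s - a)) (at s)" for a :: real
    using pos_part_square_deriv[of "s + - a"] DERIV_shift[of "\<lambda>s. (max 0 s)\<^sup>2" _ s "- a"] by simp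
  show ?thesis
    unfolding ramp_def[abs_def] hat_def
    by (rule derivative_eq_intros pos_part_square_deriv * refl)+ simp
qed

lemma hat_bounds: "0 \<le> hat s" "hat s \<le> 2"
  by (auto simp: hat_def max_def)

lemma hat_eq_0: "s \<le> 0 \<or> 1 \<le> s \<Longrightarrow> hat s = 0"
  by (auto simp: hat_def max_def)

lemma hat_lipschitz: "\<bar>hat s - hat s'\<bar> \<le> 16 * \<bar>s - s'\<bar>"
  by (auto simp: hat_def max_def abs_if)

lemma ramp_eq_0: "s \<le> 0 \<Longrightarrow> ramp s = 0"
  by (auto simp: ramp_def max_def)

lemma ramp_eq_1: "1 \<le> s \<Longrightarrow> ramp s = 1"
  by (auto simp: ramp_def max_def power2_eq_square algebra_simps)

lemma ramp_abs_le: "\<bar>ramp s\<bar> \<le> 1"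
proof -
  consider "s \<le> 0" | "0 \<le> s" "s < 1/2" | "1/2 \<le> s" "s \<le> 1" | "1 \<le> s" by linarith
  then show ?thesis
  proof cases
    case 2
    then have "s * s \<le> 1/2 * (1/2)" by (intro mult_mono) auto
    then show ?thesis using 2 by (simp add: ramp_def max_def power2_eq_square)
  next
    case 3
    have "(1 - s) * (1 - s) \<le> 1/2 * (1/2)" using 3 by (intro mult_mono) auto
    moreover have "ramp s = 1 - 2 * ((1 - s) * (1 - s))"
      using 3 by (simp add: ramp_def max_def power2_eq_square algebra_simps)
    moreover have "0 \<le> (1 - s) * (1 - s)" by simp
    ultimately show ?thesis by linarith
  qed (auto simp: ramp_eq_0 ramp_eq_1)
qed

lemma shear_zero: "shear 0 (\<lambda>_. 0)"
  unfolding shear_def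
  by (rule exI[of _ 1], rule exI[of _ 2], rule exI[of _ "\<lambda>_. 0"], rule exI[of _ 0])
    (auto intro: lipschitz_on_constant)

lemma shear_scaleR:
  assumes "shear A g"
  shows "shear (\<bar>c\<bar> * A) (\<lambda>x. c *\<^sub>R g x)"
proof -
  obtain i l f L where "i \<noteq> l" and f: "L-lipschitz_on UNIV f" "\<forall>t. \<bar>f t\<bar> \<le> A" and g: "g = (\<lambda>x. f (x $ i) *\<^sub>R axis l 1)"
    using assms unfolding shear_def by blast
  have "(\<bar>c\<bar> * L)-lipschitz_on UNIV (\<lambda>t. c * f t)"
    using f(1) by (rule lipschitz_on_cmult_real)
  moreover have "\<forall>t. \<bar>c * f t\<bar> \<le> \<bar>c\<bar> * A"
    using f(2) by (simp add: abs_mult mult_left_mono)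
  ultimately show ?thesis
    unfolding shear_def g using \<open>i \<noteq> l\<close> by fastforce
qed

section \<open>Field and flow of a sequence of shears\<close>

locale shear_sequence =
  fixes g :: "nat \<Rightarrow> real^2 \<Rightarrow> real^2" and A :: "nat \<Rightarrow> real"
  assumes shear: "\<And>n. shear (A n) (g n)"
    and summable_A: "summable (\<lambda>n. (real n + 1)\<^sup>2 * A n)"
begin

definition start :: "nat \<Rightarrow> real" where "start n = real n / (real n + 1)"

definition len :: "nat \<Rightarrow> real" where "len n = start (Suc n) - start n"

definition progress :: "nat \<Rightarrow> real \<Rightarrow> real" where "progress n t = ramp ((t - start n) / len n)"

definition speed :: "nat \<Rightarrow> real \<Rightarrow> real" where "speed n t = hat ((t - start n) / len n) / len n"

text \<open>The field, like the trajectory below, is a series over all stages instead of a case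
  distinction in time, so that uniform convergence treats t = 1 together with the earlier
  times.\<close>

definition velocity :: "real \<Rightarrow> real^2 \<Rightarrow> real^2" where
  "velocity t x = (\<Sum>n. speed n t *\<^sub>R g n x)"

definition trajectory :: "real \<Rightarrow> real^2 \<Rightarrow> real^2" where
  "trajectory t x = x + (\<Sum>n. progress n t *\<^sub>R g n (shear_iterate g n x))"

lemma len_eq: "len n = 1 / ((real n + 1) * (real n + 2))"
  by (simp add: len_def start_def field_simps)

lemma len_pos: "len n > 0"
  by (simp add: len_eq)

lemma start_mono: "m \<le> n \<Longrightarrow> start m \<le> start n"
  by (simp add: start_def field_simps)

lemma start_less_1: "start n < 1"
  by (simp add: start_def)

lemma ex_stage:
  assumes "0 \<le> t" "t < 1"
  obtains n where "start n \<le> t" "t \<le> start (Suc n)"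
proof
  \<comment> \<open>The condition \<open>start n \<le> t\<close> means n \<le> t / (1 - t), so n is
    the integer part of this quotient.\<close>
  define u where "u = t / (1 - t)"
  define n where "n = nat \<lfloor>u\<rfloor>"
  have u: "u \<ge> 0" "u * (1 - t) = t" using assms by (simp_all add: u_def)
  then have n: "real n \<le> u" "u < real n + 1" by (auto simp: n_def)
  have "real n * (1 - t) \<le> t" using mult_right_mono[OF n(1), of "1 - t"] assms u by simp
  then show "start n \<le> t" by (simp add: start_def divide_le_eq algebra_simps)
  have "t \<le> (real n + 1) * (1 - t)" using mult_right_mono[of u "real n + 1" "1 - t"] n assms u by simp
  then show "t \<le> start (Suc n)" by (simp add: start_def le_divide_eq algebra_simps)
qed

lemma progress_eq_0: "t \<le> start n \<Longrightarrow> progress n t = 0"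
  using len_pos[of n] by (simp add: progress_def ramp_eq_0 divide_nonpos_pos)

lemma progress_eq_1: "start (Suc n) \<le> t \<Longrightarrow> progress n t = 1"
  using len_pos[of n] unfolding progress_def by (intro ramp_eq_1) (simp add: le_divide_eq len_def)

lemma speed_eq_0: "t \<le> start n \<or> start (Suc n) \<le> t \<Longrightarrow> speed n t = 0"
proof -
  assume "t \<le> start n \<or> start (Suc n) \<le> t"
  then have "(t - start n) / len n \<le> 0 \<or> 1 \<le> (t - start n) / len n"
    using len_pos[of n] by (auto simp: divide_le_eq le_divide_eq len_def)
  then show ?thesis by (simp add: speed_def hat_eq_0)
qed

lemma A_nonneg: "0 \<le> A n"
  using shear_norm_le[OF shear, of n 0] norm_ge_zero order_trans by blast

lemma norm_g_le: "norm (g n x) \<le> A n"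
  using shear_norm_le[OF shear] .

lemma summable_amplitude: "summable A"
proof (rule summable_comparison_test'[OF summable_A])
  fix n :: nat
  have "1 * A n \<le> (real n + 1)\<^sup>2 * A n" using A_nonneg by (intro mult_right_mono) auto
  then show "norm (A n) \<le> (real n + 1)\<^sup>2 * A n" using A_nonneg[of n] by simp
qed

text \<open>The factor 4 comes from hat \<le> 2 and 1 / len n = (n + 1) (n + 2) \<le> 2 (n + 1)^2.
  The weight (n + 1)^2 in \<open>summable_A\<close> is there to make these bounds summable.\<close>

lemma norm_speed_term: "norm (speed n t *\<^sub>R g n x) \<le> 4 * ((real n + 1)\<^sup>2 * A n)"
proof -
  have "speed n t \<le> 2 * ((real n + 1) * (real n + 2))"
    unfolding speed_def len_eq using hat_bounds(2) by (simp add: mult_right_mono)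
  also have "\<dots> \<le> 4 * (real n + 1)\<^sup>2" by (simp add: power2_eq_square algebra_simps)
  finally have "speed n t \<le> 4 * (real n + 1)\<^sup>2" .
  moreover have "0 \<le> speed n t" using hat_bounds(1) len_pos[of n] by (simp add: speed_def)
  ultimately have "\<bar>speed n t\<bar> * norm (g n x) \<le> 4 * (real n + 1)\<^sup>2 * A n"
    using norm_g_le[of n x] by (intro mult_mono) auto
  then show ?thesis by (simp add: mult.assoc)
qed

lemma velocity_limit: "uniform_limit S (\<lambda>N (t, x). \<Sum>n<N. speed n t *\<^sub>R g n x) (\<lambda>(t, x). velocity t x) sequentially"
  using Weierstrass_m_test[of S "\<lambda>n z. speed n (fst z) *\<^sub>R g n (snd z)", OF norm_speed_term summable_mult[OF summable_A]]
  by (simp add: velocity_def case_prod_unfold)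

text \<open>Each term is Lipschitz in time and space jointly, but with constants that need not stay
  bounded in n; what survives in the uniform limit is uniform continuity.\<close>

lemma uniformly_continuous_velocity: "uniformly_continuous_on S (\<lambda>(t, x). velocity t x)"
proof (rule uniform_limit_uniformly_continuous_on[OF velocity_limit])
  fix N
  have cont_term: "uniformly_continuous_on S (\<lambda>z. speed n (fst z) *\<^sub>R g n (snd z))" for n
  proof -
    obtain L where L: "L-lipschitz_on UNIV (g n)" using shear_lipschitz[OF shear] by blast
    define B where "B = 2 / len n"
    define C where "C = 16 / len n / len n"
    have BC: "B \<ge> 0" "C \<ge> 0" "L \<ge> 0" using len_pos[of n] L lipschitz_on_nonneg by (auto simp: B_def C_def)
    have speed_B: "\<bar>speed n t\<bar> \<le> B" for t
      using hat_bounds len_pos[of n] by (simp add: speed_def B_def divide_right_mono)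
    have speed_C: "\<bar>speed n t - speed n t'\<bar> \<le> C * \<bar>t - t'\<bar>" for t t'
    proof -
      have "\<bar>speed n t - speed n t'\<bar> = \<bar>hat ((t - start n) / len n) - hat ((t' - start n) / len n)\<bar> / len n"
        using len_pos[of n] by (simp add: speed_def abs_divide flip: diff_divide_distrib)
      also have "\<dots> \<le> 16 * \<bar>(t - start n) / len n - (t' - start n) / len n\<bar> / len n"
        using len_pos[of n] by (intro divide_right_mono hat_lipschitz) auto
      also have "\<dots> = C * \<bar>t - t'\<bar>"
        using len_pos[of n] by (simp add: C_def abs_divide flip: diff_divide_distrib)
      finally show ?thesis .
    qed
    have "(C * A n + B * L)-lipschitz_on S (\<lambda>z. speed n (fst z) *\<^sub>R g n (snd z))"
    proof (rule lipschitz_onI)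
      fix z z' :: "real \<times> (real^2)"
      obtain t x t' x' where z: "z = (t, x)" "z' = (t', x')" by fastforce
      have d: "\<bar>t - t'\<bar> \<le> dist z z'" "dist x x' \<le> dist z z'"
        using dist_fst_le[of z z'] dist_snd_le[of z z'] by (auto simp: z dist_real_def)
      have "dist (speed n t *\<^sub>R g n x) (speed n t' *\<^sub>R g n x')
          = norm ((speed n t - speed n t') *\<^sub>R g n x + speed n t' *\<^sub>R (g n x - g n x'))"
        by (simp add: dist_norm algebra_simps)
      also have "\<dots> \<le> \<bar>speed n t - speed n t'\<bar> * norm (g n x) + \<bar>speed n t'\<bar> * norm (g n x - g n x')"
        by (rule norm_triangle_le) simp
      also have "\<dots> \<le> (C * dist z z') * A n + B * (L * dist z z')"
      proof (intro add_mono mult_mono)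
        show "\<bar>speed n t - speed n t'\<bar> \<le> C * dist z z'"
          using speed_C[of t t'] mult_left_mono[OF d(1) BC(2)] by linarith
        have "norm (g n x - g n x') \<le> L * dist x x'"
          using lipschitz_onD[OF L] by (simp add: dist_norm)
        also have "\<dots> \<le> L * dist z z'" using d(2) BC(3) by (rule mult_left_mono)
        finally show "norm (g n x - g n x') \<le> L * dist z z'" .
      qed (use BC speed_B norm_g_le in auto)
      finally show "dist (speed n (fst z) *\<^sub>R g n (snd z)) (speed n (fst z') *\<^sub>R g n (snd z')) \<le> (C * A n + B * L) * dist z z'"
        by (simp add: z algebra_simps)
    qed (use BC A_nonneg in auto)
    then show ?thesis by (rule lipschitz_on_uniformly_continuous)
  qed
  show "uniformly_continuous_on S (\<lambda>(t, x). \<Sum>n<N. speed n t *\<^sub>R g n x)"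
    unfolding case_prod_unfold
    by (induction N) (auto intro!: uniformly_continuous_on_const uniformly_continuous_on_add cont_term)
qed

lemma velocity_stage:
  assumes "start n \<le> t" "t \<le> start (Suc n)"
  shows "velocity t x = speed n t *\<^sub>R g n x"
proof -
  have "speed m t = 0" if "m \<noteq> n" for m
  proof (cases "m < n")
    case True
    then show ?thesis using start_mono[of "Suc m" n] assms by (intro speed_eq_0) auto
  next
    case False
    then show ?thesis using start_mono[of "Suc n" m] that assms by (intro speed_eq_0) auto
  qed
  then have "(\<Sum>m. speed m t *\<^sub>R g m x) = (\<Sum>m\<in>{n}. speed m t *\<^sub>R g m x)"
    by (intro suminf_finite) auto
  then show ?thesis by (simp add: velocity_def)
qed

lemma velocity_end: "velocity 1 x = 0"
proof -
  have "speed m 1 = 0" for m using start_less_1[of "Suc m"] by (intro speed_eq_0) auto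
  then show ?thesis by (simp add: velocity_def)
qed

lemma shear_velocity:
  assumes "t \<in> {0..1}"
  shows "\<exists>B. shear B (velocity t)"
proof (cases "t = 1")
  case True
  then have "velocity t = (\<lambda>_. 0)" by (simp add: velocity_end fun_eq_iff)
  then show ?thesis using shear_zero by auto
next
  case False
  then obtain n where "start n \<le> t" "t \<le> start (Suc n)" using assms by (auto elim: ex_stage)
  then have "velocity t = (\<lambda>x. speed n t *\<^sub>R g n x)" by (simp add: velocity_stage fun_eq_iff)
  then show ?thesis using shear_scaleR[OF shear] by auto
qed

lemma shear_iterate_sum: "(\<Sum>m<n. g m (shear_iterate g m x)) = shear_iterate g n x - x"
  by (induction n) auto

lemma trajectory_stage:
  assumes "start n \<le> t" "t \<le> start (Suc n)"
  shows "trajectory t x = shear_iterate g n x + progress n t *\<^sub>R g n (shear_iterate g n x)"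
proof -
  have "progress m t = 0" if "n < m" for m
    using start_mono[of "Suc n" m] that assms by (intro progress_eq_0) auto
  moreover have "progress m t = 1" if "m < n" for m
    using start_mono[of "Suc m" n] that assms by (intro progress_eq_1) auto
  ultimately have "(\<Sum>m. progress m t *\<^sub>R g m (shear_iterate g m x))
      = (\<Sum>m\<in>{..n}. progress m t *\<^sub>R g m (shear_iterate g m x))"
    by (intro suminf_finite) auto
  also have "\<dots> = (\<Sum>m<n. progress m t *\<^sub>R g m (shear_iterate g m x)) + progress n t *\<^sub>R g n (shear_iterate g n x)"
    by (simp flip: lessThan_Suc_atMost)
  also have "(\<Sum>m<n. progress m t *\<^sub>R g m (shear_iterate g m x)) = (\<Sum>m<n. g m (shear_iterate g m x))"
    using \<open>\<And>m. m < n \<Longrightarrow> progress m t = 1\<close> by (intro sum.cong) auto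
  finally show ?thesis by (simp add: trajectory_def shear_iterate_sum)
qed

lemma sums_trajectory: "(\<lambda>n. progress n t *\<^sub>R g n (shear_iterate g n x)) sums (trajectory t x - x)"
proof -
  have "norm (progress n t *\<^sub>R g n y) \<le> A n" for n y
    using mult_mono[OF ramp_abs_le norm_g_le] by (simp add: progress_def)
  then have "summable (\<lambda>n. progress n t *\<^sub>R g n (shear_iterate g n x))"
    by (intro summable_comparison_test'[OF summable_amplitude])
  then show ?thesis by (simp add: trajectory_def summable_sums)
qed

text \<open>During stage n the current position differs from the position at its start only along
  the shear, so \<open>g n\<close> has the same value at both; at all other times the speed is 0.
  Thus the termwise derivatives of the trajectory are the terms of the velocity along it.\<close>

lemma speed_trajectory: "speed n t *\<^sub>R g n (trajectory t x) = speed n t *\<^sub>R g n (shear_iterate g n x)"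
proof (cases "t \<le> start n \<or> start (Suc n) \<le> t")
  case True
  then show ?thesis by (simp add: speed_eq_0)
next
  case False
  then have "trajectory t x = shear_iterate g n x + progress n t *\<^sub>R g n (shear_iterate g n x)"
    by (intro trajectory_stage) auto
  then show ?thesis using shear_invariant[OF shear] by simp
qed

lemma trajectory_map: "trajectory_map 1 velocity UNIV trajectory"
  unfolding trajectory_map_def
proof (intro ballI conjI)
  fix a
  show "trajectory 0 a = a"
    using trajectory_stage[of 0 0 a] progress_eq_0[of 0 0] by (simp add: start_def)
  fix t :: real assume t: "t \<in> {0..1}"
  have "((\<lambda>s. trajectory s a - a) has_vector_derivative velocity t (trajectory t a)) (at t within {0..1})"
  proof (rule has_vector_derivative_series)
    show "((\<lambda>s. progress n s *\<^sub>R g n (shear_iterate g n a)) has_vector_derivative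
        speed n s *\<^sub>R g n (trajectory s a)) (at s within {0..1})" for n s
    proof -
      have "((\<lambda>s. (s - start n) / len n) has_real_derivative 1 / len n) (at s)"
        using len_pos[of n] by (auto intro!: derivative_eq_intros)
      then have "(progress n has_real_derivative speed n s) (at s)"
        unfolding progress_def[abs_def] speed_def using DERIV_chain'[OF _ ramp_deriv] by fastforce
      then have "(progress n has_vector_derivative speed n s) (at s within {0..1})"
        by (simp add: has_real_derivative_iff_has_vector_derivative has_vector_derivative_at_within)
      then show ?thesis
        unfolding speed_trajectory
        using has_vector_derivative_scaleR[of "progress n" "speed n s" s "{0..1}" "\<lambda>_. g n (shear_iterate g n a)" 0]
        by (simp add: has_real_derivative_iff_has_vector_derivative)
    qed
    \<comment> \<open>Uniform convergence on all of space-time is composed with the curve; it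
      includes t = 1, where infinitely many stages accumulate.\<close>
    show "uniform_limit {0..1} (\<lambda>N s. \<Sum>n<N. speed n s *\<^sub>R g n (trajectory s a)) (\<lambda>s. velocity s (trajectory s a)) sequentially"
      using uniform_limit_compose'[OF velocity_limit[of UNIV], of "\<lambda>s. (s, trajectory s a)" "{0..1}"] by simp
    show "(\<lambda>n. progress n s *\<^sub>R g n (shear_iterate g n a)) sums (trajectory s a - a)" for s
      by (rule sums_trajectory)
  qed (use t in auto)
  from has_vector_derivative_add[OF this has_vector_derivative_const[of a]]
  show "((\<lambda>s. trajectory s a) has_vector_derivative velocity t (trajectory t a)) (at t within {0..1})"
    by simp
qed

lemma shear_iterate_lipschitz: "\<exists>L. L-lipschitz_on UNIV (shear_iterate g n)"
proof (induction n)
  case 0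
  then show ?case using lipschitz_on_id by (intro exI[of _ 1]) (simp cong: lipschitz_on_cong)
next
  case (Suc n)
  then obtain L where L: "L-lipschitz_on UNIV (shear_iterate g n)" by blast
  obtain L' where L': "L'-lipschitz_on UNIV (\<lambda>x. x + 1 *\<^sub>R g n x)"
    using shear_flow_lipschitz[OF shear] by blast
  have "(L' * L)-lipschitz_on UNIV (\<lambda>x. shear_iterate g n x + 1 *\<^sub>R g n (shear_iterate g n x))"
    by (rule lipschitz_on_compose2[OF L lipschitz_on_subset[OF L']]) simp
  then show ?case by (auto cong: lipschitz_on_cong)
qed

lemma shear_iterate_inverse: "\<exists>F L. L-lipschitz_on UNIV F \<and> (\<forall>x. F (shear_iterate g n x) = x)"
proof (induction n)
  case 0
  then show ?case using lipschitz_on_id by (intro exI[of _ "\<lambda>x. x"] exI[of _ 1]) auto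
next
  case (Suc n)
  then obtain F L where F: "L-lipschitz_on UNIV F" "\<And>x. F (shear_iterate g n x) = x" by blast
  obtain L' where L': "L'-lipschitz_on UNIV (\<lambda>x. x + (- 1) *\<^sub>R g n x)"
    using shear_flow_lipschitz[OF shear] by blast
  have "(L * L')-lipschitz_on UNIV (\<lambda>x. F (x + (- 1) *\<^sub>R g n x))"
    by (rule lipschitz_on_compose2[OF L' lipschitz_on_subset[OF F(1)]]) simp
  moreover have "F (y + (- 1) *\<^sub>R g n y) = x" if "y = shear_iterate g (Suc n) x" for x y
    using that shear_invariant[OF shear, of n "shear_iterate g n x" 1] F(2) by simp
  ultimately show ?case by blast
qed

text \<open>Before time 1 only finitely many shears have acted. The inverse first undoes the partial
  shear of the current stage and then the completed ones; the constants depend on t.\<close>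

lemma trajectory_bilipschitz:
  assumes "0 \<le> t" "t < 1"
  shows "\<exists>L. L-lipschitz_on UNIV (trajectory t)"
    and "\<exists>F L. L-lipschitz_on UNIV F \<and> (\<forall>x. F (trajectory t x) = x)"
proof -
  obtain n where n: "start n \<le> t" "t \<le> start (Suc n)" using assms by (rule ex_stage)
  define s where "s = progress n t"
  have eq: "trajectory t = (\<lambda>x. shear_iterate g n x + s *\<^sub>R g n (shear_iterate g n x))"
    using trajectory_stage[OF n] by (simp add: fun_eq_iff s_def)
  obtain L where L: "L-lipschitz_on UNIV (shear_iterate g n)" using shear_iterate_lipschitz by blast
  obtain L' where L': "L'-lipschitz_on UNIV (\<lambda>x. x + s *\<^sub>R g n x)"
    using shear_flow_lipschitz[OF shear] by blast
  have "(L' * L)-lipschitz_on UNIV (trajectory t)"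
    unfolding eq by (rule lipschitz_on_compose2[OF L lipschitz_on_subset[OF L']]) simp
  then show "\<exists>L. L-lipschitz_on UNIV (trajectory t)" by blast
  obtain F M where F: "M-lipschitz_on UNIV F" "\<And>x. F (shear_iterate g n x) = x"
    using shear_iterate_inverse by blast
  obtain M' where M': "M'-lipschitz_on UNIV (\<lambda>x. x + (- s) *\<^sub>R g n x)"
    using shear_flow_lipschitz[OF shear] by blast
  have "(M * M')-lipschitz_on UNIV (\<lambda>x. F (x + (- s) *\<^sub>R g n x))"
    by (rule lipschitz_on_compose2[OF M' lipschitz_on_subset[OF F(1)]]) simp
  moreover have "F (y + (- s) *\<^sub>R g n y) = x" if "y = trajectory t x" for x y
    using that shear_invariant[OF shear, of n "shear_iterate g n x" s] F(2) by (simp add: eq)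
  ultimately show "\<exists>F L. L-lipschitz_on UNIV F \<and> (\<forall>x. F (trajectory t x) = x)" by blast
qed

lemma trajectory_end: "(\<lambda>n. shear_iterate g n x) \<longlonglongrightarrow> trajectory 1 x"
proof -
  have "progress n 1 = 1" for n using start_less_1[of "Suc n"] by (intro progress_eq_1) simp
  then have "(\<lambda>n. shear_iterate g n x - x) \<longlonglongrightarrow> trajectory 1 x - x"
    using sums_trajectory[of 1 x] by (simp add: sums_def shear_iterate_sum)
  from tendsto_add[OF this tendsto_const[of x]] show ?thesis by simp
qed

end

theorem theorem2p14:
  shows "\<exists>T>0. \<exists>(V :: real \<Rightarrow> real^2 \<Rightarrow> real^2) (S :: (real^2) set) (X :: real \<Rightarrow> real^2 \<Rightarrow> real^2).
     uniformly_continuous_on ({0..T} \<times> UNIV) (\<lambda>(t, x). V t x) \<and>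
     weakly_div_free T V \<and>
     compact S \<and> hausdorff_dim S = 2 \<and>
     trajectory_map T V UNIV X \<and>
     (\<forall>t\<in>{0..<T}. hausdorff_dim (X t ` S) = 2) \<and>
     X T ` S = {0} \<and>
     (\<forall>t\<in>{0..T}. locally_lipschitz_on (UNIV - {0}) (V t))"
proof -
  define E where "E = range (digit_point (\<lambda>_. slow_weight))"
  obtain g A r where g: "\<forall>n. shear (A n) (g n)" "summable (\<lambda>n. (real n + 1)\<^sup>2 * A n)"
    and r: "r \<longlonglongrightarrow> 0" and bound: "\<forall>j. \<forall>x\<in>E. norm (shear_iterate g (6 * j) x) \<le> r j"
    using collapsing_shears unfolding E_def by (elim exE conjE)
  interpret shear_sequence g A
    by (rule shear_sequence.intro[OF g(1)[rule_format] g(2)])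
  define S where "S = closure E"
  have E: "hoelder_onto_square E" unfolding E_def by (rule hoelder_onto_square_digit_points)
  have "E \<subseteq> S" unfolding S_def by (rule closure_subset)
  \<comment> \<open>At j = 0 the iterate is the identity, so the collapse estimate bounds E itself
    by r 0.\<close>
  have "bounded E"
    using bound[rule_format, of _ 0] by (intro boundedI[of _ "r 0"]) simp
  then have S: "compact S" "bounded S" by (auto simp: S_def)
  \<comment> \<open>The estimate is known on digit points and passes to their closure by continuity
    of the iterates.\<close>
  have S_le: "norm (shear_iterate g (6 * j) x) \<le> r j" if "x \<in> S" for x j
  proof -
    obtain L where "L-lipschitz_on UNIV (shear_iterate g (6 * j))" using shear_iterate_lipschitz by blast
    then have "continuous_on S (shear_iterate g (6 * j))"
      by (rule lipschitz_on_continuous_on[OF lipschitz_on_subset]) simp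
    then show ?thesis
      using that bound unfolding S_def
      by (intro continuous_on_closure_norm_le[of E]) auto
  qed
  have X1: "trajectory 1 x = 0" if "x \<in> S" for x
  proof -
    have "(\<lambda>j. shear_iterate g (6 * j) x) \<longlonglongrightarrow> 0"
      using S_le[OF that] by (intro Lim_null_comparison[OF _ r]) auto
    \<comment> \<open>All iterates converge to the position at time 1, so the multiples of 6
      determine the limit.\<close>
    moreover have "(\<lambda>j. shear_iterate g (6 * j) x) \<longlonglongrightarrow> trajectory 1 x"
      using LIMSEQ_subseq_LIMSEQ[OF trajectory_end[of x], of "\<lambda>j. 6 * j"]
      by (simp add: strict_mono_def o_def)
    ultimately show ?thesis by (rule LIMSEQ_unique[symmetric])
  qed
  \<comment> \<open>The lower bound comes from the image of E, the upper bound from boundedness of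
    the image of S.\<close>
  have dim_X: "hausdorff_dim (trajectory t ` S) = 2" if "t \<in> {0..<1}" for t
  proof (rule hausdorff_dim_eq_2)
    have t: "0 \<le> t" "t < 1" using that by auto
    obtain F L where "L-lipschitz_on UNIV F" "\<And>x. F (trajectory t x) = x"
      using trajectory_bilipschitz(2)[OF t] by blast
    then show "hoelder_onto_square (trajectory t ` E)"
      using hoelder_onto_square_image[OF E] by blast
    show "trajectory t ` E \<subseteq> trajectory t ` S" using \<open>E \<subseteq> S\<close> by blast
    obtain L where "L-lipschitz_on UNIV (trajectory t)"
      using trajectory_bilipschitz(1)[OF t] by blast
    then have "continuous_on S (trajectory t)"
      by (rule lipschitz_on_continuous_on[OF lipschitz_on_subset]) simp
    then show "bounded (trajectory t ` S)"
      using S(1) by (intro compact_imp_bounded compact_continuous_image)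
  qed
  have "weakly_div_free 1 velocity"
    unfolding weakly_div_free_def using shear_velocity shear_divergence_free by blast
  moreover have "trajectory 1 ` S = {0}"
  proof -
    have "S \<noteq> {}" using \<open>E \<subseteq> S\<close> by (auto simp: E_def)
    then show ?thesis using X1 by (simp add: image_constant_conv cong: image_cong)
  qed
  moreover have "\<forall>t\<in>{0..1}. locally_lipschitz_on (UNIV - {0}) (velocity t)"
  proof
    fix t :: real assume "t \<in> {0..1}"
    then obtain B where "shear B (velocity t)" using shear_velocity by blast
    then obtain L where L: "L-lipschitz_on UNIV (velocity t)" using shear_lipschitz by blast
    \<comment> \<open>At a fixed time the field is Lipschitz on the whole plane, so radius 1 works
      around every point.\<close>
    then have "L-lipschitz_on (ball x 1 \<inter> (UNIV - {0})) (velocity t)" for x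
      by (rule lipschitz_on_subset) simp
    then show "locally_lipschitz_on (UNIV - {0}) (velocity t)"
      unfolding locally_lipschitz_on_def using zero_less_one by blast
  qed
  ultimately show ?thesis
    using uniformly_continuous_velocity S(1) hausdorff_dim_eq_2[OF E \<open>E \<subseteq> S\<close> S(2)] trajectory_map dim_X
    by (intro exI[of _ 1] conjI exI[of _ velocity] exI[of _ S] exI[of _ trajectory] ballI) simp_all
qed

end
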